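(* Let $A$ be a standard-graded Artinian Gorenstein algebra over a field $\pmb k$. Assume that the minimal homogeneous resolution of $A$ by free $\operatorname{Sym}_{\bullet}^{\pmb k}A_1$-modules is Gorenstein-linear. Then every non-zero linear form in $A$ (i.e. every non-zero element of $A_1$) is a weak Lefschetz element of $A$.
   Context: Gorenstein-linear: a homogeneous complex of free modules over a graded ring $R$ is Gorenstein-linear if it has the form $0\to R(-2n-t+2)^{s_t}\to R(-n-t+2)^{s_{t-1}}\to\dots\to R(-n-1)^{s_2}\to R(-n)^{s_1}\to R^{s_0}$ for some integers $n,t,s_i$; that is, all entries of all matrices except the first and the last are linear forms, and all entries of the first and last matrices are forms of the same degree. A linear form $x_1\in A_1$ is a weak Lefschetz element of $A$ if each multiplication map $x_1:A_i\to A_{i+1}$ has maximal rank, i.e. is injective whenever $\dim_{\pmb k}A_i\le\dim_{\pmb k}A_{i+1}$ and surjective whenever $\dim_{\pmb k}A_{i+1}\le\dim_{\pmb k}A_i$. *)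

theory Defs
  imports Complex_Main "HOL-Library.Poly_Mapping"
begin

section \<open>Standard-graded Artinian Gorenstein algebras\<close>

text \<open>Commutativity, associativity and \<open>1 \<noteq> 0\<close> come from the class \<^class>\<open>comm_ring_1\<close>.\<close>

locale comm_algebra = vector_space scale
  for scale :: "'k::field \<Rightarrow> 'a::comm_ring_1 \<Rightarrow> 'a" +
  assumes scale_mult_left: "scale c (a * b) = scale c a * b"
begin

text \<open>For a grading \<open>G\<close> of the algebra, \<open>G\<^sub>1 \<oplus> G\<^sub>2 \<oplus> \<dots>\<close>.\<close>

definition positive_part :: "(nat \<Rightarrow> 'a set) \<Rightarrow> 'a set" where
  "positive_part G = span (\<Union>i\<in>{1..}. G i)"

definition forms :: "'a set \<Rightarrow> nat \<Rightarrow> 'a set" where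
  "forms V i = span {prod_list xs | xs. set xs \<subseteq> V \<and> length xs = i}"

end

locale standard_graded_algebra = comm_algebra scale
  for scale :: "'k::field \<Rightarrow> 'a::comm_ring_1 \<Rightarrow> 'a" +
  fixes A :: "nat \<Rightarrow> 'a set"
  assumes subspace_component: "subspace (A i)"
    and direct_sum: "\<exists>!f. (\<forall>i. f i \<in> A i) \<and> finite {i. f i \<noteq> 0} \<and> a = (\<Sum>i | f i \<noteq> 0. f i)"
    and mult_component: "a \<in> A i \<Longrightarrow> b \<in> A j \<Longrightarrow> a * b \<in> A (i + j)"
    and component_0: "A 0 = range (\<lambda>c. scale c 1)"
    and generated_by_component_1: "span {prod_list xs | xs. set xs \<subseteq> A 1} = UNIV"
    and finite_dimensional_component_1: "\<exists>B. finite B \<and> span B = A 1"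

definition is_ideal :: "'a::comm_ring_1 set \<Rightarrow> bool" where
  "is_ideal I \<longleftrightarrow> module.subspace (*) I"

definition artinian_ring :: "'a::comm_ring_1 itself \<Rightarrow> bool" where
  "artinian_ring _ \<longleftrightarrow>
     (\<forall>I :: nat \<Rightarrow> 'a set. (\<forall>n. is_ideal (I n)) \<and> (\<forall>n. I (Suc n) \<subseteq> I n) \<longrightarrow>
        (\<exists>N. \<forall>n\<ge>N. I n = I N))"

definition socle :: "('k::field \<Rightarrow> 'a::comm_ring_1 \<Rightarrow> 'a) \<Rightarrow> (nat \<Rightarrow> 'a set) \<Rightarrow> 'a set" where
  "socle scale A = {a. \<forall>m \<in> comm_algebra.positive_part scale A. a * m = 0}"

text \<open>An Artinian standard-graded algebra over a field is local with residue field the ground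
  field, so it is Gorenstein when its socle is one-dimensional over the ground field.\<close>

definition artinian_gorenstein ::
    "('k::field \<Rightarrow> 'a::comm_ring_1 \<Rightarrow> 'a) \<Rightarrow> (nat \<Rightarrow> 'a set) \<Rightarrow> bool" where
  "artinian_gorenstein scale A \<longleftrightarrow>
     artinian_ring TYPE('a) \<and> vector_space.dim scale (socle scale A) = 1"

definition weak_Lefschetz_element ::
    "('k::field \<Rightarrow> 'a::comm_ring_1 \<Rightarrow> 'a) \<Rightarrow> (nat \<Rightarrow> 'a set) \<Rightarrow> 'a \<Rightarrow> bool" where
  "weak_Lefschetz_element scale A x \<longleftrightarrow> x \<in> A 1 \<and>
     (\<forall>i. (vector_space.dim scale (A i) \<le> vector_space.dim scale (A (i + 1)) \<longrightarrow>
             inj_on (\<lambda>a. x * a) (A i)) \<and>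
          (vector_space.dim scale (A (i + 1)) \<le> vector_space.dim scale (A i) \<longrightarrow>
             (\<lambda>a. x * a) ` A i = A (i + 1)))"

definition algebra_hom ::
    "('k::field \<Rightarrow> 'a::comm_ring_1 \<Rightarrow> 'a) \<Rightarrow> ('k \<Rightarrow> 'b::comm_ring_1 \<Rightarrow> 'b) \<Rightarrow> ('a \<Rightarrow> 'b) \<Rightarrow> bool" where
  "algebra_hom scaleA scaleB h \<longleftrightarrow> h 1 = 1 \<and>
     (\<forall>a b. h (a + b) = h a + h b) \<and> (\<forall>a b. h (a * b) = h a * h b) \<and>
     (\<forall>c a. h (scaleA c a) = scaleB c (h a))"


section \<open>The symmetric algebra of a vector space\<close>

text \<open>
  \<open>Sym V\<close> is presented as the free commutative algebra on the set \<open>V\<close>, one variable \<open>X v\<close> for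
  each \<open>v \<in> V\<close>, modulo the ideal generated by the elements \<open>X (u + v) - X u - X v\<close> and
  \<open>X (c v) - c X v\<close>. Polynomials are finitely supported functions from monomials to coefficients.
\<close>

type_synonym ('v, 'k) polynomial = "('v \<Rightarrow>\<^sub>0 nat) \<Rightarrow>\<^sub>0 'k"

definition polys_on :: "'v set \<Rightarrow> ('v, 'k::field) polynomial set" where
  "polys_on V = {p. \<forall>m \<in> Poly_Mapping.keys p. Poly_Mapping.keys m \<subseteq> V}"

definition pconst :: "'k::field \<Rightarrow> ('v, 'k) polynomial" where
  "pconst c = Poly_Mapping.single 0 c"

definition pvar :: "'v \<Rightarrow> ('v, 'k::field) polynomial" where
  "pvar v = Poly_Mapping.single (Poly_Mapping.single v 1) 1"

definition poly_eval ::
    "('k::field \<Rightarrow> 's::comm_ring_1 \<Rightarrow> 's) \<Rightarrow> ('v \<Rightarrow> 's) \<Rightarrow> ('v, 'k) polynomial \<Rightarrow> 's" where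
  "poly_eval scaleS \<iota> p =
     (\<Sum>m \<in> Poly_Mapping.keys p. scaleS (Poly_Mapping.lookup p m)
        (\<Prod>v \<in> Poly_Mapping.keys m. \<iota> v ^ Poly_Mapping.lookup m v))"

definition linearity_relations ::
    "('k::field \<Rightarrow> 'v::ab_group_add \<Rightarrow> 'v) \<Rightarrow> 'v set \<Rightarrow> ('v, 'k) polynomial set" where
  "linearity_relations scaleV V =
     {pvar (u + v) - pvar u - pvar v | u v. u \<in> V \<and> v \<in> V} \<union>
     {pvar (scaleV c v) - pconst c * pvar v | c v. v \<in> V}"

definition linearity_ideal ::
    "('k::field \<Rightarrow> 'v::ab_group_add \<Rightarrow> 'v) \<Rightarrow> 'v set \<Rightarrow> ('v, 'k) polynomial set" where
  "linearity_ideal scaleV V =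
     {\<Sum>r\<in>T. q r * r | T q. finite T \<and> T \<subseteq> linearity_relations scaleV V \<and> q ` T \<subseteq> polys_on V}"

text \<open>
  The algebra on the type \<open>'s\<close>, together with \<open>\<iota> : V \<rightarrow> 's\<close>, is a symmetric algebra of the
  subspace \<open>V\<close> of \<open>'v\<close>: the algebra map \<open>X v \<mapsto> \<iota> v\<close> identifies it with the above quotient. The
  values of \<open>\<iota>\<close> outside \<open>V\<close> play no role.
\<close>

locale symmetric_algebra =
  V: vector_space scaleV + comm_algebra scaleS
  for scaleV :: "'k::field \<Rightarrow> 'v::ab_group_add \<Rightarrow> 'v"
    and V :: "'v set"
    and scaleS :: "'k \<Rightarrow> 's::comm_ring_1 \<Rightarrow> 's"
    and \<iota> :: "'v \<Rightarrow> 's" +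
  assumes subspace_V: "V.subspace V"
    and eval_surj: "poly_eval scaleS \<iota> ` polys_on V = UNIV"
    and eval_kernel: "{p \<in> polys_on V. poly_eval scaleS \<iota> p = 0} = linearity_ideal scaleV V"


section \<open>Homogeneous free resolutions\<close>

text \<open>
  A homogeneous complex \<open>\<dots> \<rightarrow> F\<^sub>2 \<rightarrow> F\<^sub>1 \<rightarrow> F\<^sub>0 \<rightarrow> M\<close> with
  \<open>F\<^sub>i = \<Oplus>\<^sub>j R(- shift i j)\<close>, where \<open>j < rank i\<close>. The differential from \<open>F\<close> in position
  \<open>Suc i\<close> to \<open>F\<close> in position \<open>i\<close> is the matrix \<open>diff i\<close>, with entries \<open>diff i j k\<close> for
  \<open>j < rank i\<close> and \<open>k < rank (Suc i)\<close>, and \<open>aug j\<close> is the image in \<open>M\<close> of the \<open>j\<close>-th basis vector of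
  \<open>F\<^sub>0\<close>. Values at indices out of range play no role.
\<close>

record ('s, 'm) free_complex =
  rank :: "nat \<Rightarrow> nat"
  shift :: "nat \<Rightarrow> nat \<Rightarrow> int"
  diff :: "nat \<Rightarrow> nat \<Rightarrow> nat \<Rightarrow> 's"
  aug :: "nat \<Rightarrow> 'm"

definition free_module :: "('s::comm_ring_1, 'm, 'z) free_complex_scheme \<Rightarrow> nat \<Rightarrow> (nat \<Rightarrow> 's) set" where
  "free_module F i = {v. \<forall>j \<ge> rank F i. v j = 0}"

definition diff_map ::
    "('s::comm_ring_1, 'm, 'z) free_complex_scheme \<Rightarrow> nat \<Rightarrow> (nat \<Rightarrow> 's) \<Rightarrow> (nat \<Rightarrow> 's)" where
  "diff_map F i v =
     (\<lambda>j. if j < rank F i then \<Sum>k < rank F (Suc i). diff F i j k * v k else 0)"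

text \<open>The target is a module over \<open>'s\<close> through the ring homomorphism \<open>\<pi>\<close>.\<close>

definition aug_map ::
    "('s::comm_ring_1 \<Rightarrow> 'a::comm_ring_1) \<Rightarrow> ('s, 'a, 'z) free_complex_scheme \<Rightarrow> (nat \<Rightarrow> 's) \<Rightarrow> 'a" where
  "aug_map \<pi> F v = (\<Sum>j < rank F 0. \<pi> (v j) * aug F j)"

definition int_graded :: "(nat \<Rightarrow> 'a::zero set) \<Rightarrow> int \<Rightarrow> 'a set" where
  "int_graded G d = (if d < 0 then {0} else G (nat d))"

definition homogeneous_complex ::
    "(nat \<Rightarrow> 's::comm_ring_1 set) \<Rightarrow> (nat \<Rightarrow> 'a::comm_ring_1 set) \<Rightarrow>
     ('s, 'a, 'z) free_complex_scheme \<Rightarrow> bool" where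
  "homogeneous_complex S A F \<longleftrightarrow>
     (\<forall>i. \<forall>j < rank F i. \<forall>k < rank F (Suc i).
        diff F i j k \<in> int_graded S (shift F (Suc i) k - shift F i j)) \<and>
     (\<forall>j < rank F 0. aug F j \<in> int_graded A (shift F 0 j))"

definition exact_complex ::
    "('s::comm_ring_1 \<Rightarrow> 'a::comm_ring_1) \<Rightarrow> ('s, 'a, 'z) free_complex_scheme \<Rightarrow> bool" where
  "exact_complex \<pi> F \<longleftrightarrow>
     aug_map \<pi> F ` free_module F 0 = UNIV \<and>
     {v \<in> free_module F 0. aug_map \<pi> F v = 0} = diff_map F 0 ` free_module F 1 \<and>
     (\<forall>i. {v \<in> free_module F (Suc i). diff_map F i v = (\<lambda>_. 0)} =
            diff_map F (Suc i) ` free_module F (Suc (Suc i)))"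

text \<open>\<open>S\<close> is the grading of the coefficient ring and \<open>A\<close> the grading of the resolved algebra.
  Minimality: the image of each differential lies in the homogeneous maximal ideal times its
  target.\<close>

definition minimal_homogeneous_resolution ::
    "('k::field \<Rightarrow> 's::comm_ring_1 \<Rightarrow> 's) \<Rightarrow> (nat \<Rightarrow> 's set) \<Rightarrow> (nat \<Rightarrow> 'a::comm_ring_1 set) \<Rightarrow>
     ('s \<Rightarrow> 'a) \<Rightarrow> ('s, 'a, 'z) free_complex_scheme \<Rightarrow> bool" where
  "minimal_homogeneous_resolution scaleS S A \<pi> F \<longleftrightarrow>
     homogeneous_complex S A F \<and> exact_complex \<pi> F \<and>
     (\<forall>i. \<forall>j < rank F i. \<forall>k < rank F (Suc i).
        diff F i j k \<in> comm_algebra.positive_part scaleS S)"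

text \<open>
  \<open>0 \<rightarrow> R(-2n-t+2) \<rightarrow> R(-n-t+2) \<rightarrow> \<dots> \<rightarrow> R(-n-1) \<rightarrow> R(-n) \<rightarrow> R\<close>, each module with a multiplicity.
  Multiplicities, \<open>rank F t\<close> included, may be zero. Hence a complex with a single matrix, whose
  entries are all of one arbitrary degree \<open>n\<close>, qualifies, with \<open>t = 2\<close> and \<open>rank F 2 = 0\<close>.
\<close>

definition Gorenstein_linear :: "('s, 'm, 'z) free_complex_scheme \<Rightarrow> bool" where
  "Gorenstein_linear F \<longleftrightarrow> (\<exists>(n::int) (t::nat).
     (\<forall>i > t. rank F i = 0) \<and>
     (\<forall>i \<le> t. \<forall>j < rank F i. shift F i j =
        (if i = 0 then 0 else if i < t then n + int i - 1 else 2 * n + int t - 2)))"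

end

theory Submission
  imports Defs
begin

text \<open>
  Let \<open>R = Sym A\<^sub>1\<close>, let \<open>d = dim A\<^sub>1\<close>, let \<open>e\<close> be the socle degree of \<open>A\<close>, and let \<open>n\<close>, \<open>t\<close> be the
  numbers in the shape of the resolution. The proof rests on two facts about \<open>A\<close>: it agrees with
  \<open>R\<close> in degrees less than \<open>n\<close>, and \<open>e \<le> 2n - 2\<close>.

  The first fact holds because the relations of \<open>A\<close> are generated in the degrees of \<open>F\<^sub>1\<close>, which are
  at least \<open>n\<close>. As a non-zero linear form \<open>x\<close> is a nonzerodivisor on \<open>R\<close>, multiplication by \<open>x\<close> is
  injective on \<open>A\<^sub>i\<close> for \<open>i + 1 < n\<close>. The pairing \<open>A\<^sub>i \<times> A\<^sub>e\<^sub>-\<^sub>i \<rightarrow> A\<^sub>e\<close> is perfect, so multiplication by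
  \<open>x\<close> on \<open>A\<^sub>i\<close> is dual to multiplication by \<open>x\<close> on \<open>A\<^sub>e\<^sub>-\<^sub>i\<^sub>-\<^sub>1\<close>, and is therefore surjective as soon as
  \<open>e - i - 1 < n - 1\<close>. When \<open>e \<le> 2n - 2\<close>, every \<open>i\<close> falls under one of the two cases
  (\<open>weak_Lefschetz_of_injective\<close>).

  For the second fact, a socle element of degree \<open>e\<close> forces \<open>F\<^sub>d\<close> to have a basis element of degree
  exactly \<open>e + d\<close> (\<open>generator_of_socle_class\<close>). The degrees in \<open>F\<^sub>d\<close> are all equal to \<open>n + d - 1\<close> if
  \<open>d < t\<close> and to \<open>2n + d - 2\<close> if \<open>d = t\<close>, so that \<open>e\<close> is \<open>n - 1\<close> or \<open>2n - 2\<close>.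

  The basis element of degree \<open>e + d\<close> is found by moving along the resolution one variable at a time.
  Let \<open>y\<^sub>1, \<dots>, y\<^sub>d\<close> be a basis of the linear forms and let \<open>J\<^sub>p = (y\<^sub>1, \<dots>, y\<^sub>p)\<close>. Since the variables
  form a regular sequence, \<open>F \<otimes> R/J\<^sub>p\<close> is exact in the positions above \<open>p\<close>
  (\<open>exact_mod_add_regular\<close>). Suppose that \<open>w \<in> F\<^sub>p\<close> of degree \<open>e + p\<close> represents a non-zero element
  of the cokernel of \<open>F\<^sub>p\<^sub>+\<^sub>1 \<rightarrow> F\<^sub>p\<close> modulo \<open>J\<^sub>p\<close> that is killed by the linear forms. Then
  \<open>y\<^sub>p\<^sub>+\<^sub>1 w\<close> is the image of some \<open>u \<in> F\<^sub>p\<^sub>+\<^sub>1\<close> of degree \<open>e + p + 1\<close> modulo \<open>J\<^sub>p\<close>, and \<open>u\<close> has the same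
  property with \<open>p + 1\<close> in place of \<open>p\<close> (\<open>socle_class_step\<close>). It starts from a lift to \<open>F\<^sub>0\<close> of a
  socle element. After \<open>d\<close> steps there is a vector of degree \<open>e + d\<close> in \<open>F\<^sub>d\<close> that is not zero modulo
  the maximal ideal, so one of its coefficients has degree \<open>0\<close>.
\<close>


section \<open>Algebras over a field\<close>

lemma module_times: "module ((*) :: 's::comm_ring_1 \<Rightarrow> 's \<Rightarrow> 's)"
  by unfold_locales (auto simp: algebra_simps)

context comm_algebra
begin

lemma scale_mult_right: "scale c (a * b) = a * scale c b"
  using scale_mult_left[of c b a] by (simp add: mult.commute)

lemma linear_mult: "Vector_Spaces.linear scale scale (\<lambda>b. a * b)"
  by (simp add: Vector_Spaces.linear_iff vector_space_axioms distrib_left scale_mult_right)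

lemma span_mult:
  assumes "a \<in> span X" "b \<in> span Y"
  shows "a * b \<in> span {x * y | x y. x \<in> X \<and> y \<in> Y}" (is "_ \<in> span ?XY")
proof -
  have 1: "x * b \<in> span ?XY" if "x \<in> X" for x
    using assms(2)
  proof (induction rule: span_induct_alt)
    case base
    then show ?case by (simp add: span_zero)
  next
    case (step c y z)
    have "x * y \<in> span ?XY" using that step by (intro span_base) blast
    then show ?case using step
      by (simp add: distrib_left scale_mult_right[symmetric] span_add span_scale)
  qed
  from assms(1) show ?thesis
  proof (induction rule: span_induct_alt)
    case base
    then show ?case by (simp add: span_zero)
  next
    case (step c y z)
    then show ?case using 1[of y]
      by (simp add: distrib_right scale_mult_left[symmetric] span_add span_scale)
  qed
qed

lemma subspace_forms [simp]: "subspace (forms V i)"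
  by (simp add: forms_def)

lemma prod_list_in_forms: "set xs \<subseteq> V \<Longrightarrow> prod_list xs \<in> forms V (length xs)"
  unfolding forms_def by (intro span_base) blast

lemma forms_mult:
  assumes "a \<in> forms V i" "b \<in> forms V j"
  shows "a * b \<in> forms V (i + j)"
proof -
  have "{x * y | x y. x \<in> {prod_list xs | xs. set xs \<subseteq> V \<and> length xs = i} \<and>
      y \<in> {prod_list xs | xs. set xs \<subseteq> V \<and> length xs = j}}
    \<subseteq> {prod_list xs | xs. set xs \<subseteq> V \<and> length xs = i + j}"
    (is "?L \<subseteq> ?R")
  proof
    fix z assume "z \<in> ?L"
    then obtain xs ys where "z = prod_list (xs @ ys)" "set (xs @ ys) \<subseteq> V" "length (xs @ ys) = i + j"
      by auto
    then show "z \<in> ?R" by blast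
  qed
  then show ?thesis
    using span_mult[OF assms[unfolded forms_def]] span_mono unfolding forms_def by blast
qed

lemma one_in_forms: "1 \<in> forms V 0"
  using prod_list_in_forms[of "[]" V] by simp

lemma in_forms_1: "v \<in> V \<Longrightarrow> v \<in> forms V 1"
  using prod_list_in_forms[of "[v]" V] by simp

lemma power_in_forms: "v \<in> V \<Longrightarrow> v ^ n \<in> forms V n"
proof (induction n)
  case 0
  then show ?case by (simp add: one_in_forms)
next
  case (Suc n)
  then show ?case using forms_mult[OF in_forms_1] by fastforce
qed

lemma prod_in_forms:
  assumes "finite I" "\<And>i. i \<in> I \<Longrightarrow> f i \<in> forms V (n i)"
  shows "prod f I \<in> forms V (sum n I)"
  using assms by (induction I rule: finite_induct) (auto simp: one_in_forms intro: forms_mult)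

end


section \<open>Evaluation of polynomials\<close>

lemma sum_single_lookup:
  fixes p :: "'b \<Rightarrow>\<^sub>0 'c::comm_monoid_add"
  shows "(\<Sum>m \<in> Poly_Mapping.keys p. Poly_Mapping.single m (Poly_Mapping.lookup p m)) = p"
proof (rule poly_mapping_eqI)
  fix k
  have "(\<Sum>m \<in> Poly_Mapping.keys p. Poly_Mapping.lookup p m when m = k)
      = (if k \<in> Poly_Mapping.keys p then Poly_Mapping.lookup p k else 0)"
    by (simp add: when_def sum.delta)
  then show "Poly_Mapping.lookup
      (\<Sum>m \<in> Poly_Mapping.keys p. Poly_Mapping.single m (Poly_Mapping.lookup p m)) k
    = Poly_Mapping.lookup p k"
    by (simp add: lookup_sum lookup_single in_keys_iff)
qed

lemma keys_add_nat:
  "Poly_Mapping.keys (m + m') = Poly_Mapping.keys m \<union> Poly_Mapping.keys (m' :: 'v \<Rightarrow>\<^sub>0 nat)"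
  by (auto simp: in_keys_iff lookup_add)

text \<open>The value of a monomial when each variable \<open>v\<close> is replaced by \<open>\<iota> v\<close>.\<close>

definition monomial_eval :: "('v \<Rightarrow> 's::comm_ring_1) \<Rightarrow> ('v \<Rightarrow>\<^sub>0 nat) \<Rightarrow> 's" where
  "monomial_eval \<iota> m = (\<Prod>v \<in> Poly_Mapping.keys m. \<iota> v ^ Poly_Mapping.lookup m v)"

lemma monomial_eval_superset:
  assumes "finite K" "Poly_Mapping.keys m \<subseteq> K"
  shows "monomial_eval \<iota> m = (\<Prod>v \<in> K. \<iota> v ^ Poly_Mapping.lookup m v)"
  unfolding monomial_eval_def using assms by (intro prod.mono_neutral_left) (auto simp: in_keys_iff)

lemma monomial_eval_add: "monomial_eval \<iota> (m + m') = monomial_eval \<iota> m * monomial_eval \<iota> m'"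
proof -
  let ?K = "Poly_Mapping.keys m \<union> Poly_Mapping.keys m'"
  show ?thesis
    by (simp add: monomial_eval_superset[of ?K] keys_add_nat lookup_add power_add prod.distrib)
qed

lemma monomial_eval_0 [simp]: "monomial_eval \<iota> 0 = 1"
  by (simp add: monomial_eval_def)

lemma monomial_eval_single [simp]: "monomial_eval \<iota> (Poly_Mapping.single v 1) = \<iota> v"
  by (simp add: monomial_eval_def)

lemma monomial_eval_pvar: "monomial_eval pvar m = Poly_Mapping.single m 1"
proof -
  have pw: "pvar v ^ n = (Poly_Mapping.single (Poly_Mapping.single v n) 1 :: ('v, 'k::field) polynomial)"
    for v :: 'v and n
    by (induction n) (simp_all add: pvar_def mult_single single_add[symmetric])
  have pr: "(\<Prod>v\<in>K. Poly_Mapping.single (f v) 1) = (Poly_Mapping.single (\<Sum>v\<in>K. f v) 1 :: ('v, 'k::field) polynomial)"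
    if "finite K" for K and f :: "'v \<Rightarrow> 'v \<Rightarrow>\<^sub>0 nat"
    using that by (induction K rule: finite_induct) (simp_all add: mult_single)
  show ?thesis
    unfolding monomial_eval_def pw by (subst pr) (simp_all add: sum_single_lookup)
qed

context comm_algebra
begin

lemma poly_eval_eq:
  assumes "finite K" "Poly_Mapping.keys p \<subseteq> K"
  shows "poly_eval scale \<iota> p = (\<Sum>m \<in> K. scale (Poly_Mapping.lookup p m) (monomial_eval \<iota> m))"
  unfolding poly_eval_def monomial_eval_def using assms
  by (intro sum.mono_neutral_left) (auto simp: in_keys_iff)

lemma poly_eval_single [simp]:
  "poly_eval scale \<iota> (Poly_Mapping.single m c) = scale c (monomial_eval \<iota> m)"
  by (simp add: poly_eval_eq[of "{m}"])

lemma poly_eval_pvar [simp]: "poly_eval scale \<iota> (pvar v) = \<iota> v"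
  using monomial_eval_single[of \<iota> v] by (simp add: pvar_def del: monomial_eval_single)

lemma poly_eval_zero [simp]: "poly_eval scale \<iota> 0 = 0"
  by (simp add: poly_eval_def)

lemma poly_eval_pconst [simp]: "poly_eval scale \<iota> (pconst c) = scale c 1"
  by (simp add: pconst_def)

lemma poly_eval_add: "poly_eval scale \<iota> (p + q) = poly_eval scale \<iota> p + poly_eval scale \<iota> q"
proof -
  let ?K = "Poly_Mapping.keys p \<union> Poly_Mapping.keys q"
  show ?thesis
    using keys_add[of p q]
    by (simp add: poly_eval_eq[of ?K] lookup_add scale_left_distrib sum.distrib)
qed

lemma poly_eval_diff: "poly_eval scale \<iota> (p - q) = poly_eval scale \<iota> p - poly_eval scale \<iota> q"
  using poly_eval_add[of \<iota> "p - q" q] by simp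

lemma poly_eval_sum: "poly_eval scale \<iota> (sum f I) = (\<Sum>i\<in>I. poly_eval scale \<iota> (f i))"
  by (induction I rule: infinite_finite_induct) (simp_all add: poly_eval_add)

lemma poly_eval_mult: "poly_eval scale \<iota> (p * q) = poly_eval scale \<iota> p * poly_eval scale \<iota> q"
proof -
  have 1: "poly_eval scale \<iota> (Poly_Mapping.single m c * Poly_Mapping.single l d)
    = poly_eval scale \<iota> (Poly_Mapping.single m c) * poly_eval scale \<iota> (Poly_Mapping.single l d)"
    for m l c d
  proof -
    have "scale c (monomial_eval \<iota> m) * scale d (monomial_eval \<iota> l)
        = scale c (scale d (monomial_eval \<iota> m * monomial_eval \<iota> l))"
      by (simp only: scale_mult_left[symmetric] scale_mult_right[symmetric])
         (rule scale_left_commute)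
    then show ?thesis by (simp add: mult_single monomial_eval_add)
  qed
  have "poly_eval scale \<iota> ((\<Sum>m \<in> Poly_Mapping.keys p. Poly_Mapping.single m (Poly_Mapping.lookup p m)) *
      (\<Sum>m \<in> Poly_Mapping.keys q. Poly_Mapping.single m (Poly_Mapping.lookup q m)))
    = poly_eval scale \<iota> (\<Sum>m \<in> Poly_Mapping.keys p. Poly_Mapping.single m (Poly_Mapping.lookup p m)) *
      poly_eval scale \<iota> (\<Sum>m \<in> Poly_Mapping.keys q. Poly_Mapping.single m (Poly_Mapping.lookup q m))"
    by (simp only: sum_product poly_eval_sum 1)
  then show ?thesis by (simp only: sum_single_lookup)
qed

lemma poly_eval_pconst_mult: "poly_eval scale \<iota> (pconst c * p) = scale c (poly_eval scale \<iota> p)"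
  by (simp add: poly_eval_mult scale_mult_left[symmetric])

end

lemma polys_on_monomials: "p \<in> polys_on V \<Longrightarrow> m \<in> Poly_Mapping.keys p \<Longrightarrow> Poly_Mapping.keys m \<subseteq> V"
  by (simp add: polys_on_def)

lemma polys_on_add: "p \<in> polys_on V \<Longrightarrow> q \<in> polys_on V \<Longrightarrow> p + q \<in> polys_on V"
  using keys_add[of p q] by (auto simp: polys_on_def)

lemma polys_on_uminus: "p \<in> polys_on V \<Longrightarrow> - p \<in> polys_on V"
  by (auto simp: polys_on_def in_keys_iff)

lemma polys_on_mult:
  assumes "p \<in> polys_on V" "q \<in> polys_on V"
  shows "p * q \<in> polys_on V"
  unfolding polys_on_def
proof safe
  fix m v assume "m \<in> Poly_Mapping.keys (p * q)" and v: "v \<in> Poly_Mapping.keys m"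
  then obtain a b where "m = a + b" "a \<in> Poly_Mapping.keys p" "b \<in> Poly_Mapping.keys q"
    using keys_mult[of p q] by blast
  with v show "v \<in> V" using polys_on_monomials assms by (auto simp: keys_add_nat)
qed

lemma polys_on_pconst [simp]: "pconst c \<in> polys_on V"
  by (simp add: polys_on_def pconst_def)

lemma polys_on_pvar: "v \<in> V \<Longrightarrow> pvar v \<in> polys_on V"
  by (simp add: polys_on_def pvar_def)

lemma polys_on_mono: "V \<subseteq> W \<Longrightarrow> polys_on V \<subseteq> polys_on W"
  by (auto simp: polys_on_def)

lemma pconst_mult_distrib: "pconst (c * d) = pconst c * pconst d"
  by (simp add: pconst_def mult_single)

lemma pconst_add: "pconst (c + d) = pconst c + pconst d"
  by (simp add: pconst_def single_add)

lemma pconst_0 [simp]: "pconst 0 = 0" and pconst_1 [simp]: "pconst 1 = 1"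
  by (simp_all add: pconst_def)

lemma comm_algebra_polynomial:
  "comm_algebra (\<lambda>c p. pconst c * p :: ('v, 'k::field) polynomial)"
  by unfold_locales (simp_all add: pconst_mult_distrib pconst_add algebra_simps)


section \<open>The symmetric algebra as a polynomial ring\<close>

text \<open>A symmetric algebra of a finite-dimensional space with a chosen basis \<open>B\<close>. It is identified below
  with the polynomials in the variables \<open>B\<close>.\<close>

locale symmetric_algebra_basis = symmetric_algebra scaleV V scaleS \<iota>
  for scaleV :: "'k::field \<Rightarrow> 'v::ab_group_add \<Rightarrow> 'v"
    and V :: "'v set"
    and scaleS :: "'k \<Rightarrow> 's::comm_ring_1 \<Rightarrow> 's"
    and \<iota> :: "'v \<Rightarrow> 's" +
  fixes B :: "'v set"
  assumes finite_B: "finite B"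
    and independent_B: "V.independent B"
    and span_B: "V.span B = V"
begin

abbreviation ev :: "('v, 'k) polynomial \<Rightarrow> 's" where
  "ev \<equiv> poly_eval scaleS \<iota>"

lemma B_subset: "B \<subseteq> V"
  using span_B V.span_superset by blast

lemma poly_eval_relation:
  assumes "r \<in> linearity_relations scaleV V"
  shows "ev r = 0"
proof -
  have "(\<Sum>r\<in>{r}. (\<lambda>_. pconst 1) r * r) \<in> linearity_ideal scaleV V"
    unfolding linearity_ideal_def using assms
    by (intro CollectI exI[of _ "{r}"] exI[of _ "\<lambda>_. pconst 1"] conjI refl)
      (auto simp del: pconst_1)
  then have "r \<in> linearity_ideal scaleV V" by simp
  then show ?thesis using eval_kernel by blast
qed

lemma \<iota>_add:
  assumes "u \<in> V" "v \<in> V"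
  shows "\<iota> (u + v) = \<iota> u + \<iota> v"
proof -
  have "pvar (u + v) - pvar u - pvar v \<in> linearity_relations scaleV V"
    using assms unfolding linearity_relations_def by blast
  from poly_eval_relation[OF this] show ?thesis by (simp add: poly_eval_diff diff_diff_eq poly_eval_add)
qed

lemma \<iota>_scale:
  assumes "v \<in> V"
  shows "\<iota> (scaleV c v) = scaleS c (\<iota> v)"
proof -
  have "pvar (scaleV c v) - pconst c * pvar v \<in> linearity_relations scaleV V"
    using assms unfolding linearity_relations_def by blast
  from poly_eval_relation[OF this] show ?thesis
    by (simp add: poly_eval_diff poly_eval_pconst_mult)
qed

lemma \<iota>_zero: "\<iota> 0 = 0"
  using \<iota>_scale[of 0 0] subspace_V V.subspace_0 by simp

text \<open>A property of elements of \<open>V\<close> can be checked on the image of the basis.\<close>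

lemma \<iota>_in_subspace:
  assumes "subspace T" "\<And>b. b \<in> B \<Longrightarrow> \<iota> b \<in> T" "v \<in> V"
  shows "\<iota> v \<in> T"
proof -
  have "v \<in> V.span B" using assms(3) span_B by simp
  then have "\<iota> v \<in> T \<and> v \<in> V"
  proof (induction rule: V.span_induct_alt)
    case base
    then show ?case using assms(1) subspace_V V.subspace_0 by (simp add: \<iota>_zero subspace_0)
  next
    case (step c x y)
    then have x: "x \<in> V" using B_subset by auto
    have cx: "scaleV c x \<in> V" using x subspace_V V.subspace_scale by blast
    have "scaleV c x + y \<in> V" using step cx subspace_V V.subspace_add by blast
    moreover have "\<iota> (scaleV c x + y) \<in> T"
      using step x cx assms(1,2) by (simp add: \<iota>_add \<iota>_scale subspace_add subspace_scale)
    ultimately show ?case by blast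
  qed
  then show ?thesis by blast
qed

lemma poly_eval_surj_on_basis: "ev ` polys_on B = UNIV"
proof -
  let ?E = "ev ` polys_on B"
  have add: "a + b \<in> ?E" if "a \<in> ?E" "b \<in> ?E" for a b
    using that by (auto simp: poly_eval_add[symmetric] intro!: imageI polys_on_add)
  have mult: "a * b \<in> ?E" if "a \<in> ?E" "b \<in> ?E" for a b
    using that by (auto simp: poly_eval_mult[symmetric] intro!: imageI polys_on_mult)
  have scale: "scaleS c b \<in> ?E" if "b \<in> ?E" for b c
    using that by (auto simp: poly_eval_pconst_mult[symmetric] intro!: imageI polys_on_mult)
  have one: "1 \<in> ?E"
    using imageI[OF polys_on_pconst[of 1 B], of ev] by (simp del: pconst_1)
  have zero: "0 \<in> ?E"
    using scale[OF one, of 0] by simp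
  have "subspace ?E"
    by (intro subspaceI zero add scale)
  have \<iota>: "\<iota> v \<in> ?E" if "v \<in> V" for v
    using \<open>subspace ?E\<close> _ that
  proof (rule \<iota>_in_subspace)
    show "\<iota> b \<in> ?E" if "b \<in> B" for b
      using imageI[OF polys_on_pvar[OF that], of ev] by simp
  qed
  have power: "a ^ n \<in> ?E" if "a \<in> ?E" for a n
    using that by (induction n) (auto intro: one mult)
  have prod: "prod f I \<in> ?E" if "finite I" "\<And>i. i \<in> I \<Longrightarrow> f i \<in> ?E" for f :: "'v \<Rightarrow> 's" and I
    using that by (induction I rule: finite_induct) (auto intro: one mult)
  have "ev p \<in> ?E" if "p \<in> polys_on V" for p
    using \<open>subspace ?E\<close> polys_on_monomials[OF that]
    by (subst poly_eval_def, intro subspace_sum scale prod power \<iota>) auto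
  then show ?thesis using eval_surj by (metis UNIV_I UNIV_eq_I imageE)
qed

text \<open>Substituting for each variable \<open>v \<in> V\<close> its expression in the basis kills the linearity
  relations and fixes the polynomials in the basis.\<close>

lemma poly_eval_inj_on_basis:
  assumes "p \<in> polys_on B" "ev p = 0"
  shows "p = 0"
proof -
  \<comment> \<open>\<open>L v\<close> is the expression of \<open>v\<close> in the basis\<close>
  define L :: "'v \<Rightarrow> ('v, 'k) polynomial" where
    "L v = (\<Sum>b\<in>B. pconst (V.representation B v b) * pvar b)" for v
  define sc :: "'k \<Rightarrow> ('v, 'k) polynomial \<Rightarrow> ('v, 'k) polynomial" where
    "sc c p = pconst c * p" for c p
  interpret P: comm_algebra sc
    using comm_algebra_polynomial by (simp add: sc_def[abs_def])
  have L_add: "L (u + v) = L u + L v" if "u \<in> V" "v \<in> V" for u v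
    using that independent_B span_B
    by (simp add: L_def V.representation_add pconst_add distrib_right sum.distrib)
  have L_scale: "L (scaleV c v) = pconst c * L v" if "v \<in> V" for c v
    using that independent_B span_B
    by (simp add: L_def V.representation_scale pconst_mult_distrib sum_distrib_left mult.assoc)
  have L_basis: "L b = pvar b" if "b \<in> B" for b
  proof -
    have "L b = (\<Sum>b'\<in>B. if b = b' then pvar b' else 0)"
      unfolding L_def using that independent_B
      by (intro sum.cong) (auto simp: V.representation_basis)
    then show ?thesis using that finite_B by simp
  qed
  have rel: "poly_eval sc L r = 0" if "r \<in> linearity_relations scaleV V" for r
    using that by (auto simp: linearity_relations_def P.poly_eval_diff P.poly_eval_mult
        L_add L_scale) (auto simp: sc_def)
  have "p \<in> linearity_ideal scaleV V"
    using assms B_subset polys_on_mono eval_kernel by blast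
  then obtain T q where "p = (\<Sum>r\<in>T. q r * r)" "T \<subseteq> linearity_relations scaleV V"
    unfolding linearity_ideal_def by blast
  then have "poly_eval sc L p = 0"
    by (simp add: P.poly_eval_sum P.poly_eval_mult rel subset_iff)
  moreover have "poly_eval sc L p = p"
  proof -
    have "monomial_eval L m = Poly_Mapping.single m 1" if "m \<in> Poly_Mapping.keys p" for m
      using polys_on_monomials[OF assms(1) that] L_basis
      by (subst monomial_eval_pvar[symmetric]) (auto simp: monomial_eval_def intro!: prod.cong)
    then have "poly_eval sc L p
        = (\<Sum>m \<in> Poly_Mapping.keys p. Poly_Mapping.single m (Poly_Mapping.lookup p m))"
      by (simp add: P.poly_eval_eq[OF finite_keys subset_refl] sc_def pconst_def mult_single)
    then show ?thesis by (simp add: sum_single_lookup)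
  qed
  ultimately show ?thesis by simp
qed

text \<open>The polynomial in the basis \<open>B\<close> that represents an element of the symmetric algebra, and
  the monomials that occur in it.\<close>

definition poly_of :: "'s \<Rightarrow> ('v, 'k) polynomial" where
  "poly_of s = inv_into (polys_on B) ev s"

definition monomials :: "'s \<Rightarrow> ('v \<Rightarrow>\<^sub>0 nat) set" where
  "monomials s = Poly_Mapping.keys (poly_of s)"

lemma poly_of_in [simp]: "poly_of s \<in> polys_on B"
  unfolding poly_of_def by (rule inv_into_into) (simp add: poly_eval_surj_on_basis)

lemma ev_poly_of [simp]: "ev (poly_of s) = s"
  unfolding poly_of_def by (rule f_inv_into_f) (simp add: poly_eval_surj_on_basis)

lemma poly_of_ev:
  assumes "p \<in> polys_on B"
  shows "poly_of (ev p) = p"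
proof -
  have "poly_of (ev p) + - p \<in> polys_on B"
    by (intro polys_on_add polys_on_uminus assms poly_of_in)
  then show ?thesis
    using poly_eval_inj_on_basis[of "poly_of (ev p) - p"] by (simp add: poly_eval_diff)
qed

lemma poly_of_eqI: "p \<in> polys_on B \<Longrightarrow> ev p = s \<Longrightarrow> poly_of s = p"
  using poly_of_ev by blast

lemma poly_of_add: "poly_of (a + b) = poly_of a + poly_of b"
  by (rule poly_of_eqI) (simp_all add: polys_on_add poly_eval_add)

lemma poly_of_mult: "poly_of (a * b) = poly_of a * poly_of b"
  by (rule poly_of_eqI) (simp_all add: polys_on_mult poly_eval_mult)

lemma poly_of_scale: "poly_of (scaleS c a) = pconst c * poly_of a"
  by (rule poly_of_eqI) (simp_all add: polys_on_mult poly_eval_pconst_mult)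

lemma poly_of_zero [simp]: "poly_of 0 = 0"
  by (rule poly_of_eqI) (simp_all add: polys_on_def)

lemma poly_of_one [simp]: "poly_of 1 = 1"
  by (rule poly_of_eqI) (simp_all add: polys_on_def poly_eval_def)

lemma poly_of_var: "b \<in> B \<Longrightarrow> poly_of (\<iota> b) = pvar b"
  by (rule poly_of_eqI) (simp_all add: polys_on_pvar)

lemma poly_of_eq_0_iff: "poly_of s = 0 \<longleftrightarrow> s = 0"
  using ev_poly_of[of s] by fastforce

lemma monomials_zero [simp]: "monomials 0 = {}"
  by (simp add: monomials_def)

lemma monomials_empty_iff: "monomials s = {} \<longleftrightarrow> s = 0"
proof -
  have "Poly_Mapping.keys p = {} \<longleftrightarrow> p = 0" for p :: "('v, 'k) polynomial"
    by (metis keys_zero poly_mapping_eqI in_keys_iff empty_iff lookup_zero)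
  then show ?thesis by (simp add: monomials_def poly_of_eq_0_iff)
qed

lemma monomials_add: "monomials (a + b) \<subseteq> monomials a \<union> monomials b"
  by (simp add: monomials_def poly_of_add keys_add)

lemma monomials_mult: "monomials (a * b) \<subseteq> {m + m' | m m'. m \<in> monomials a \<and> m' \<in> monomials b}"
  using keys_mult[of "poly_of a" "poly_of b"] by (auto simp: monomials_def poly_of_mult)

lemma monomials_scale: "monomials (scaleS c a) \<subseteq> monomials a"
proof -
  have "Poly_Mapping.keys (pconst c * poly_of a) \<subseteq> Poly_Mapping.keys (poly_of a)"
    using keys_mult[of "pconst c" "poly_of a"] by (auto simp: pconst_def split: if_splits)
  then show ?thesis by (simp add: monomials_def poly_of_scale)
qed

lemma monomials_var: "b \<in> B \<Longrightarrow> monomials (\<iota> b) = {Poly_Mapping.single b 1}"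
  by (simp add: monomials_def poly_of_var pvar_def)

lemma subspace_monomials: "subspace {s. \<forall>m\<in>monomials s. P m}"
  using monomials_add monomials_scale by (intro subspaceI) (auto, blast+)

text \<open>The sum of the terms of \<open>s\<close> whose monomial satisfies \<open>P\<close>.\<close>

definition part :: "(('v \<Rightarrow>\<^sub>0 nat) \<Rightarrow> bool) \<Rightarrow> 's \<Rightarrow> 's" where
  "part P s = ev (Poly_Mapping.mapp (\<lambda>m c. if P m then c else 0) (poly_of s))"

lemma poly_of_part:
  "poly_of (part P s) = Poly_Mapping.mapp (\<lambda>m c. if P m then c else 0) (poly_of s)"
  unfolding part_def using keys_mapp_subset polys_on_monomials[OF poly_of_in[of s]]
  by (intro poly_of_ev) (force simp: polys_on_def)

lemma lookup_part:
  "Poly_Mapping.lookup (poly_of (part P s)) m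
    = (if P m then Poly_Mapping.lookup (poly_of s) m else 0)"
  by (simp add: poly_of_part lookup_mapp when_def in_keys_iff)

lemma monomials_part: "monomials (part P s) = {m \<in> monomials s. P m}"
  by (auto simp: monomials_def in_keys_iff lookup_part split: if_splits)

lemma poly_of_inject: "poly_of a = poly_of b \<Longrightarrow> a = b"
  by (metis ev_poly_of)

lemma part_add: "part P (a + b) = part P a + part P b"
  by (intro poly_of_inject poly_mapping_eqI) (simp add: lookup_part poly_of_add lookup_add)

lemma part_zero [simp]: "part P 0 = 0"
  using monomials_part[of P 0] monomials_empty_iff by simp

lemma part_diff: "part P (a - b) = part P a - part P b"
  using part_add[of P "a - b" b] by simp

lemma part_sum: "part P (sum f I) = (\<Sum>i\<in>I. part P (f i))"
  by (induction I rule: infinite_finite_induct) (simp_all add: part_add)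

lemma part_all: "(\<And>m. m \<in> monomials s \<Longrightarrow> P m) \<Longrightarrow> part P s = s"
  by (intro poly_of_inject poly_mapping_eqI) (auto simp: lookup_part monomials_def in_keys_iff)

lemma part_none: "(\<And>m. m \<in> monomials s \<Longrightarrow> \<not> P m) \<Longrightarrow> part P s = 0"
  using monomials_part[of P s] monomials_empty_iff by blast

lemma part_compl: "part P s + part (\<lambda>m. \<not> P m) s = s"
  by (intro poly_of_inject poly_mapping_eqI) (simp add: lookup_part poly_of_add lookup_add)


section \<open>Homogeneous components\<close>

text \<open>The total degree of a monomial.\<close>

definition mdeg :: "('v \<Rightarrow>\<^sub>0 nat) \<Rightarrow> nat" where
  "mdeg m = (\<Sum>v \<in> Poly_Mapping.keys m. Poly_Mapping.lookup m v)"

lemma mdeg_superset: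
  "finite K \<Longrightarrow> Poly_Mapping.keys m \<subseteq> K \<Longrightarrow> mdeg m = (\<Sum>v \<in> K. Poly_Mapping.lookup m v)"
  unfolding mdeg_def by (intro sum.mono_neutral_left) (auto simp: in_keys_iff)

lemma mdeg_add: "mdeg (m + m') = mdeg m + mdeg m'"
  by (simp add: mdeg_superset[of "Poly_Mapping.keys m \<union> Poly_Mapping.keys m'"]
      keys_add_nat lookup_add sum.distrib)

lemma mdeg_single [simp]: "mdeg (Poly_Mapping.single v n) = n"
  by (simp add: mdeg_def)

text \<open>The standard grading of the symmetric algebra.\<close>

abbreviation S :: "nat \<Rightarrow> 's set" where
  "S \<equiv> forms (\<iota> ` V)"

text \<open>The grading by products of linear forms is the grading by the total degree in the basis.\<close>

lemma S_iff: "s \<in> S i \<longleftrightarrow> (\<forall>m\<in>monomials s. mdeg m = i)"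
proof
  let ?H = "\<lambda>i. {s. \<forall>m\<in>monomials s. mdeg m = i}"
  have \<iota>: "\<iota> v \<in> ?H 1" if "v \<in> V" for v
    using subspace_monomials _ that by (rule \<iota>_in_subspace) (simp add: monomials_var)
  have prod: "prod_list xs \<in> ?H (length xs)" if "set xs \<subseteq> \<iota> ` V" for xs
    using that
  proof (induction xs)
    case Nil
    then show ?case by (auto simp: monomials_def mdeg_def)
  next
    case (Cons x xs)
    then have "x \<in> ?H 1" "prod_list xs \<in> ?H (length xs)"
      using \<iota> by auto
    then show ?case using monomials_mult[of x "prod_list xs"] by (force simp: mdeg_add)
  qed
  assume "s \<in> S i"
  moreover have "{prod_list xs | xs. set xs \<subseteq> \<iota> ` V \<and> length xs = i} \<subseteq> ?H i"
    using prod by blast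
  ultimately have "s \<in> ?H i"
    using span_minimal[OF _ subspace_monomials] unfolding forms_def by blast
  then show "\<forall>m\<in>monomials s. mdeg m = i" by simp
next
  assume deg: "\<forall>m\<in>monomials s. mdeg m = i"
  have "monomial_eval \<iota> m \<in> S i" if "m \<in> monomials s" for m
  proof -
    have "monomial_eval \<iota> m \<in> S (mdeg m)"
      unfolding monomial_eval_def mdeg_def
      using that polys_on_monomials[OF poly_of_in] B_subset unfolding monomials_def
      by (intro prod_in_forms power_in_forms) (auto, blast)
    then show ?thesis using deg that by simp
  qed
  then have "ev (poly_of s) \<in> S i"
    unfolding poly_eval_eq[OF finite_keys subset_refl] monomials_def
    by (intro subspace_sum subspace_forms subspace_scale)
  then show "s \<in> S i" by simp
qed

text \<open>The homogeneous component of degree \<open>D\<close>. The degree is an integer, as the shifts of a complex are,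
  and the components of negative degree vanish.\<close>

definition hcomp :: "int \<Rightarrow> 's \<Rightarrow> 's" where
  "hcomp D = part (\<lambda>m. int (mdeg m) = D)"

lemma int_graded_S_iff: "s \<in> int_graded S D \<longleftrightarrow> (\<forall>m\<in>monomials s. int (mdeg m) = D)"
  by (auto simp: int_graded_def S_iff monomials_empty_iff[symmetric])

lemma hcomp_in: "hcomp D s \<in> int_graded S D"
  by (simp add: hcomp_def int_graded_S_iff monomials_part)

lemma hcomp_same: "s \<in> int_graded S D \<Longrightarrow> hcomp D s = s"
  by (simp add: hcomp_def int_graded_S_iff part_all)

lemma int_graded_S_mult: "a \<in> int_graded S D \<Longrightarrow> b \<in> int_graded S E \<Longrightarrow> a * b \<in> int_graded S (D + E)"
  using monomials_mult[of a b] by (fastforce simp: int_graded_S_iff mdeg_add)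

lemma hcomp_mult:
  assumes "a \<in> int_graded S E"
  shows "hcomp D (a * s) = a * hcomp (D - E) s"
proof -
  define r where "r = part (\<lambda>m. int (mdeg m) \<noteq> D - E) s"
  have s: "s = hcomp (D - E) s + r"
    by (simp add: hcomp_def r_def part_compl)
  have "a * hcomp (D - E) s \<in> int_graded S (E + (D - E))"
    by (intro int_graded_S_mult assms hcomp_in)
  then have 1: "hcomp D (a * hcomp (D - E) s) = a * hcomp (D - E) s"
    by (intro hcomp_same) simp
  have 2: "hcomp D (a * r) = 0"
    unfolding hcomp_def using assms monomials_mult[of a r]
    by (intro part_none) (force simp: r_def monomials_part int_graded_S_iff mdeg_add)
  have "hcomp D (a * s) = hcomp D (a * hcomp (D - E) s) + hcomp D (a * r)"
    by (subst s) (simp add: hcomp_def part_add distrib_left)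
  then show ?thesis using 1 2 by simp
qed


section \<open>Ideals generated by variables\<close>

text \<open>The ideal generated by the variables in \<open>X\<close>, described as the elements all of whose monomials
  involve a variable of \<open>X\<close>. The lemmas \<open>var_ideal_insert\<close> and \<open>var_ideal_insertI\<close> give the relation
  to generators.\<close>

definition var_ideal :: "'v set \<Rightarrow> 's set" where
  "var_ideal X = {s. \<forall>m\<in>monomials s. Poly_Mapping.keys m \<inter> X \<noteq> {}}"

lemma is_ideal_var_ideal: "is_ideal (var_ideal X)"
proof -
  interpret R: module "(*) :: 's \<Rightarrow> 's \<Rightarrow> 's" by (rule module_times)
  have "R.subspace (var_ideal X)"
  proof (rule R.subspaceI)
    show "0 \<in> var_ideal X" by (simp add: var_ideal_def)
    show "a + b \<in> var_ideal X" if "a \<in> var_ideal X" "b \<in> var_ideal X" for a b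
      using that monomials_add[of a b] unfolding var_ideal_def by blast
    show "c * a \<in> var_ideal X" if "a \<in> var_ideal X" for c a
      using that monomials_mult[of c a] unfolding var_ideal_def
      by (force simp: keys_add_nat)
  qed
  then show ?thesis by (simp add: is_ideal_def)
qed

lemma var_ideal_empty: "var_ideal {} = {0}"
  by (auto simp: var_ideal_def monomials_empty_iff[symmetric])

lemma hcomp_var_ideal: "s \<in> var_ideal X \<Longrightarrow> hcomp D s \<in> var_ideal X"
  by (simp add: var_ideal_def hcomp_def monomials_part)

lemma S_subset_var_ideal:
  assumes "s \<in> S i" "i > 0"
  shows "s \<in> var_ideal B"
proof -
  have "Poly_Mapping.keys m \<inter> B \<noteq> {}" if m: "m \<in> monomials s" for m
  proof
    assume "Poly_Mapping.keys m \<inter> B = {}"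
    moreover have "Poly_Mapping.keys m \<subseteq> B"
      using m polys_on_monomials[OF poly_of_in] by (simp add: monomials_def)
    ultimately have "mdeg m = 0" by (auto simp: mdeg_def)
    then show False using assms m by (simp add: S_iff)
  qed
  then show ?thesis by (simp add: var_ideal_def)
qed

text \<open>A variable outside \<open>X\<close> is a nonzerodivisor modulo the variables in \<open>X\<close>.\<close>

lemma var_regular:
  assumes b: "b \<in> B" "b \<notin> X" and s: "\<iota> b * s \<in> var_ideal X"
  shows "s \<in> var_ideal X"
proof -
  let ?b = "Poly_Mapping.single b (1::nat)"
  have shift: "Poly_Mapping.lookup (pvar b * p) (?b + m) = Poly_Mapping.lookup p m"
    for p :: "('v, 'k) polynomial" and m
  proof -
    have "pvar b * p
      = pvar b * (\<Sum>m \<in> Poly_Mapping.keys p. Poly_Mapping.single m (Poly_Mapping.lookup p m))"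
      by (simp add: sum_single_lookup)
    also have "Poly_Mapping.lookup \<dots> (?b + m)
        = (\<Sum>m'\<in>Poly_Mapping.keys p. if m' = m then Poly_Mapping.lookup p m' else 0)"
      by (simp add: pvar_def sum_distrib_left mult_single lookup_sum lookup_single when_def)
    finally show ?thesis by (simp add: sum.delta in_keys_iff)
  qed
  have "Poly_Mapping.keys m \<inter> X \<noteq> {}" if "m \<in> monomials s" for m
  proof -
    have "?b + m \<in> monomials (\<iota> b * s)"
      using that b by (simp add: monomials_def poly_of_mult poly_of_var in_keys_iff shift del: One_nat_def)
    then have "Poly_Mapping.keys (?b + m) \<inter> X \<noteq> {}"
      using s by (simp add: var_ideal_def)
    then show ?thesis using b by (auto simp: keys_add_nat)
  qed
  then show ?thesis by (simp add: var_ideal_def)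
qed

lemma var_divides:
  assumes b: "b \<in> B" and s: "\<forall>m\<in>monomials s. b \<in> Poly_Mapping.keys m"
  obtains r where "s = \<iota> b * r"
proof -
  let ?b = "Poly_Mapping.single b (1::nat)"
  have eq: "?b + (m - ?b) = m" if "m \<in> monomials s" for m
  proof (rule poly_mapping_eqI)
    fix v
    have "Poly_Mapping.lookup m b \<noteq> 0" using s that by (simp add: in_keys_iff)
    then show "Poly_Mapping.lookup (?b + (m - ?b)) v = Poly_Mapping.lookup m v"
      by (auto simp: lookup_add lookup_minus lookup_single when_def)
  qed
  have "s = (\<Sum>m\<in>monomials s. scaleS (Poly_Mapping.lookup (poly_of s) m) (monomial_eval \<iota> m))"
    unfolding monomials_def by (subst poly_eval_eq[symmetric]) simp_all
  also have "\<dots> = (\<Sum>m\<in>monomials s. scaleS (Poly_Mapping.lookup (poly_of s) m)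
      (monomial_eval \<iota> (?b + (m - ?b))))"
    using eq by (intro sum.cong) simp_all
  also have "\<dots> = \<iota> b * (\<Sum>m\<in>monomials s. scaleS (Poly_Mapping.lookup (poly_of s) m)
      (monomial_eval \<iota> (m - ?b)))"
    by (simp only: monomial_eval_add monomial_eval_single scale_mult_right sum_distrib_left)
  finally show ?thesis by (rule that)
qed

lemma var_ideal_insert:
  assumes b: "b \<in> B" and s: "s \<in> var_ideal (insert b X)"
  obtains a r where "a \<in> var_ideal X" "s = a + \<iota> b * r"
proof -
  define P where "P = (\<lambda>m :: 'v \<Rightarrow>\<^sub>0 nat. Poly_Mapping.keys m \<inter> X \<noteq> {})"
  have "\<forall>m\<in>monomials (part (\<lambda>m. \<not> P m) s). b \<in> Poly_Mapping.keys m"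
    using s by (auto simp: monomials_part P_def var_ideal_def)
  then obtain r where "part (\<lambda>m. \<not> P m) s = \<iota> b * r"
    using var_divides b by metis
  then have "s = part P s + \<iota> b * r"
    using part_compl[of P s] by simp
  moreover have "part P s \<in> var_ideal X"
    by (simp add: var_ideal_def monomials_part P_def)
  ultimately show ?thesis using that by blast
qed

lemma var_ideal_insertI:
  assumes b: "b \<in> B" and a: "a \<in> var_ideal X"
  shows "a + \<iota> b * r \<in> var_ideal (insert b X)"
proof -
  have "\<forall>m\<in>monomials (\<iota> b * r). b \<in> Poly_Mapping.keys m"
    using monomials_mult[of "\<iota> b" r] b by (force simp: monomials_var keys_add_nat)
  then show ?thesis
    using a monomials_add[of a "\<iota> b * r"] unfolding var_ideal_def by blast
qed

end


section \<open>Free complexes modulo an ideal\<close>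

lemma is_ideal_zero: "is_ideal J \<Longrightarrow> 0 \<in> J"
  and is_ideal_add: "is_ideal J \<Longrightarrow> a \<in> J \<Longrightarrow> b \<in> J \<Longrightarrow> a + b \<in> J"
  and is_ideal_diff: "is_ideal J \<Longrightarrow> a \<in> J \<Longrightarrow> b \<in> J \<Longrightarrow> a - b \<in> J"
  and is_ideal_mult: "is_ideal J \<Longrightarrow> a \<in> J \<Longrightarrow> c * a \<in> J"
  and is_ideal_sum: "is_ideal J \<Longrightarrow> (\<And>i. i \<in> I \<Longrightarrow> f i \<in> J) \<Longrightarrow> sum f I \<in> J"
  unfolding is_ideal_def
  using module.subspace_0[OF module_times] module.subspace_add[OF module_times]
    module.subspace_diff[OF module_times] module.subspace_scale[OF module_times]
    module.subspace_sum[OF module_times] by blast+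

lemma diff_map_diff: "diff_map F i (\<lambda>k. a k - b k) j = diff_map F i a j - diff_map F i b j"
  by (simp add: diff_map_def right_diff_distrib sum_subtractf)

lemma diff_map_mult: "diff_map F i (\<lambda>k. c * a k) j = c * diff_map F i a j"
  by (simp add: diff_map_def sum_distrib_left mult.left_commute)

lemma diff_map_in_ideal: "is_ideal J \<Longrightarrow> (\<And>k. v k \<in> J) \<Longrightarrow> diff_map F i v j \<in> J"
  by (auto simp: diff_map_def is_ideal_zero intro!: is_ideal_sum is_ideal_mult)

lemma diff_map_in_free_module: "diff_map F i v \<in> free_module F i"
  by (simp add: diff_map_def free_module_def)

lemma free_module_diff: "a \<in> free_module F i \<Longrightarrow> b \<in> free_module F i \<Longrightarrow> (\<lambda>k. a k - b k) \<in> free_module F i"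
  and free_module_mult: "a \<in> free_module F i \<Longrightarrow> (\<lambda>k. c * a k) \<in> free_module F i"
  by (simp_all add: free_module_def)

text \<open>Two consecutive differentials compose to zero; nothing is required of the augmentation.\<close>

definition is_complex :: "('s::comm_ring_1, 'm, 'z) free_complex_scheme \<Rightarrow> bool" where
  "is_complex F \<longleftrightarrow>
     (\<forall>i. \<forall>v\<in>free_module F (Suc (Suc i)). diff_map F i (diff_map F (Suc i) v) = (\<lambda>_. 0))"

text \<open>Exactness of \<open>F \<otimes> R/J\<close> in position \<open>i + 1\<close>, for the coefficient ring \<open>R\<close>.\<close>

definition exact_mod :: "'s::comm_ring_1 set \<Rightarrow> ('s, 'm, 'z) free_complex_scheme \<Rightarrow> nat \<Rightarrow> bool" where
  "exact_mod J F i \<longleftrightarrow>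
     (\<forall>v\<in>free_module F (Suc i). (\<forall>j. diff_map F i v j \<in> J) \<longrightarrow>
        (\<exists>u\<in>free_module F (Suc (Suc i)). \<forall>k. v k - diff_map F (Suc i) u k \<in> J))"

lemma exact_modE:
  assumes "exact_mod J F i" "v \<in> free_module F (Suc i)" "\<And>j. diff_map F i v j \<in> J"
  obtains u where "u \<in> free_module F (Suc (Suc i))" "\<And>k. v k - diff_map F (Suc i) u k \<in> J"
  using assms unfolding exact_mod_def by blast

text \<open>A vector over \<open>J + (y)\<close> is divisible by \<open>y\<close> modulo \<open>J\<close>.\<close>

lemma free_module_split:
  assumes "is_ideal J" "v \<in> free_module F i"
    and "\<And>k. \<exists>a\<in>J. \<exists>r. v k = a + y * r"
  obtains w where "w \<in> free_module F i" "\<And>k. v k - y * w k \<in> J"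
proof -
  have "\<exists>r. v k - y * r \<in> J" for k
  proof -
    obtain a r where "a \<in> J" "v k = a + y * r" using assms(3) by blast
    then show ?thesis by (intro exI[of _ r]) simp
  qed
  then obtain r where r: "\<And>k. v k - y * r k \<in> J" by metis
  define w where "w k = (if k < rank F i then r k else 0)" for k
  have "v k - y * w k \<in> J" for k
    using r[of k] assms(1,2) by (auto simp: w_def free_module_def is_ideal_zero)
  moreover have "w \<in> free_module F i" by (simp add: w_def free_module_def)
  ultimately show ?thesis using that by blast
qed

text \<open>Exactness in two consecutive positions modulo \<open>J\<close> gives exactness modulo \<open>J + (y)\<close> in the
  left one, when \<open>y\<close> is a nonzerodivisor modulo \<open>J\<close>.\<close>

lemma exact_mod_add_regular:
  assumes J: "is_ideal J" and F: "is_complex F"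
    and regular: "\<And>s. y * s \<in> J \<Longrightarrow> s \<in> J"
    and J'_D: "\<And>s. s \<in> J' \<Longrightarrow> \<exists>a\<in>J. \<exists>r. s = a + y * r"
    and J'_I: "\<And>a r. a \<in> J \<Longrightarrow> a + y * r \<in> J'"
    and ex: "exact_mod J F i" "exact_mod J F (Suc i)"
  shows "exact_mod J' F (Suc i)"
  unfolding exact_mod_def
proof (intro ballI impI)
  let ?d = "diff_map F i" and ?d' = "diff_map F (Suc i)" and ?d'' = "diff_map F (Suc (Suc i))"
  fix v assume v: "v \<in> free_module F (Suc (Suc i))" and dv: "\<forall>j. ?d' v j \<in> J'"
  obtain w where w: "w \<in> free_module F (Suc i)" and dvw: "\<And>j. ?d' v j - y * w j \<in> J"
    by (rule free_module_split[OF J diff_map_in_free_module J'_D[OF dv[rule_format]]]) (rule that)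
  have "?d w j \<in> J" for j
  proof -
    have "?d (\<lambda>k. ?d' v k - y * w k) j \<in> J"
      using J dvw by (rule diff_map_in_ideal)
    then have "0 - y * ?d w j \<in> J"
      using F v by (simp add: is_complex_def diff_map_diff diff_map_mult)
    then have "- 1 * (0 - y * ?d w j) \<in> J"
      using J by (rule is_ideal_mult[rotated])
    then have "y * ?d w j \<in> J" by simp
    then show ?thesis by (rule regular)
  qed
  obtain u where u: "u \<in> free_module F (Suc (Suc i))" and wu: "\<And>k. w k - ?d' u k \<in> J"
    using \<open>\<And>j. ?d w j \<in> J\<close> by (rule exact_modE[OF ex(1) w]) (rule that)
  have dvu: "?d' (\<lambda>k. v k - y * u k) j \<in> J" for j
  proof -
    have "(?d' v j - y * w j) + y * (w j - ?d' u j) \<in> J"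
      using J dvw wu by (intro is_ideal_add is_ideal_mult)
    then show ?thesis by (simp add: diff_map_diff diff_map_mult algebra_simps)
  qed
  have vu: "(\<lambda>k. v k - y * u k) \<in> free_module F (Suc (Suc i))"
    using v u by (intro free_module_diff free_module_mult)
  obtain t where t: "t \<in> free_module F (Suc (Suc (Suc i)))"
      and *: "\<And>k. v k - y * u k - ?d'' t k \<in> J"
    using dvu by (rule exact_modE[OF ex(2) vu]) (rule that)
  have "v k - ?d'' t k \<in> J'" for k
    using J'_I[OF *, of k "u k"] by (simp add: algebra_simps)
  with t show "\<exists>t\<in>free_module F (Suc (Suc (Suc i))). \<forall>k. v k - ?d'' t k \<in> J'" by blast
qed


section \<open>Socle classes along a free resolution\<close>

context symmetric_algebra_basis
begin

text \<open>The vector \<open>w\<close> is homogeneous of degree \<open>D\<close> and represents a non-zero element, killed by all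
  linear forms, of the cokernel of \<open>F\<^sub>i\<^sub>+\<^sub>1 \<rightarrow> F\<^sub>i\<close> modulo \<open>J\<close>.\<close>

definition socle_class ::
    "'s set \<Rightarrow> ('s, 'm, 'z) free_complex_scheme \<Rightarrow> nat \<Rightarrow> int \<Rightarrow> (nat \<Rightarrow> 's) \<Rightarrow> bool" where
  "socle_class J F i D w \<longleftrightarrow> w \<in> free_module F i \<and>
     (\<forall>j < rank F i. w j \<in> int_graded S (D - shift F i j)) \<and>
     (\<forall>m\<in>S 1. \<exists>u\<in>free_module F (Suc i). \<forall>j. m * w j - diff_map F i u j \<in> J) \<and>
     \<not> (\<exists>u\<in>free_module F (Suc i). \<forall>j. w j - diff_map F i u j \<in> J)"

lemma \<iota>_in_S: "v \<in> V \<Longrightarrow> \<iota> v \<in> S 1"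
  by (intro in_forms_1 imageI)

text \<open>Homogeneous lifts can be chosen in congruences.\<close>

lemma homogeneous_lift:
  assumes F: "\<forall>j < rank F i. \<forall>k < rank F (Suc i).
      diff F i j k \<in> int_graded S (shift F (Suc i) k - shift F i j)"
    and v: "v \<in> free_module F i" "\<forall>j < rank F i. v j \<in> int_graded S (D - shift F i j)"
    and u: "\<And>j. v j - diff_map F i u j \<in> var_ideal X"
  obtains u' where "u' \<in> free_module F (Suc i)"
    "\<forall>k < rank F (Suc i). u' k \<in> int_graded S (D - shift F (Suc i) k)"
    "\<And>j. v j - diff_map F i u' j \<in> var_ideal X"
proof -
  define u' where "u' k = (if k < rank F (Suc i) then hcomp (D - shift F (Suc i) k) (u k) else 0)" for k
  have "v j - diff_map F i u' j \<in> var_ideal X" for j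
  proof (cases "j < rank F i")
    case True
    let ?D = "D - shift F i j"
    have "hcomp ?D (diff F i j k * u k) = diff F i j k * u' k" if "k < rank F (Suc i)" for k
    proof -
      have "hcomp ?D (diff F i j k * u k)
          = diff F i j k * hcomp (?D - (shift F (Suc i) k - shift F i j)) (u k)"
        using F True that by (intro hcomp_mult) blast
      then show ?thesis using that by (simp add: u'_def)
    qed
    then have "hcomp ?D (diff_map F i u j) = diff_map F i u' j"
      using True by (simp add: diff_map_def hcomp_def part_sum)
    moreover have "hcomp ?D (v j) = v j"
      using v True by (intro hcomp_same) blast
    ultimately show ?thesis
      using hcomp_var_ideal[OF u, of ?D j] by (simp add: hcomp_def part_diff)
  next
    case False
    then show ?thesis using u[of j] by (simp add: diff_map_def)
  qed
  moreover have "u' \<in> free_module F (Suc i)" by (simp add: u'_def free_module_def)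
  moreover have "\<forall>k < rank F (Suc i). u' k \<in> int_graded S (D - shift F (Suc i) k)"
    by (simp add: u'_def hcomp_in)
  ultimately show ?thesis using that by blast
qed

lemma socle_class_step:
  assumes F: "is_complex F" "\<forall>j < rank F i. \<forall>k < rank F (Suc i).
      diff F i j k \<in> int_graded S (shift F (Suc i) k - shift F i j)"
    and b: "b \<in> B" "b \<notin> X"
    and ex: "exact_mod (var_ideal X) F i"
    and w: "socle_class (var_ideal X) F i D w"
  shows "\<exists>u. socle_class (var_ideal (insert b X)) F (Suc i) (D + 1) u"
proof -
  let ?J = "var_ideal X" and ?d = "diff_map F i" and ?d' = "diff_map F (Suc i)"
  define y where "y = \<iota> b"
  have J: "is_ideal ?J" by (rule is_ideal_var_ideal)
  have y: "y \<in> S 1" using b B_subset \<iota>_in_S by (auto simp: y_def)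
  have w_free: "w \<in> free_module F i"
    and w_deg: "\<And>j. j < rank F i \<Longrightarrow> w j \<in> int_graded S (D - shift F i j)"
    and w_soc: "\<And>m. m \<in> S 1 \<Longrightarrow> \<exists>u\<in>free_module F (Suc i). \<forall>j. m * w j - ?d u j \<in> ?J"
    and w_nz: "\<And>u. u \<in> free_module F (Suc i) \<Longrightarrow> (\<And>j. w j - ?d u j \<in> ?J) \<Longrightarrow> False"
    using w unfolding socle_class_def by blast+
  \<comment> \<open>a preimage of \<open>y w\<close> modulo \<open>J\<close> is the new class\<close>
  obtain u0 where u0: "\<And>j. y * w j - ?d u0 j \<in> ?J"
    using w_soc[OF y] by blast
  have "\<forall>j < rank F i. y * w j \<in> int_graded S (D + 1 - shift F i j)"
  proof (intro allI impI)
    fix j assume "j < rank F i"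
    have "y \<in> int_graded S 1" using y by (simp add: int_graded_def)
    from int_graded_S_mult[OF this w_deg[OF \<open>j < rank F i\<close>]]
    show "y * w j \<in> int_graded S (D + 1 - shift F i j)" by (simp add: algebra_simps)
  qed
  then obtain u where u_free: "u \<in> free_module F (Suc i)"
    and u_deg: "\<forall>k < rank F (Suc i). u k \<in> int_graded S (D + 1 - shift F (Suc i) k)"
    and u: "\<And>j. y * w j - ?d u j \<in> ?J"
    using homogeneous_lift[OF F(2) free_module_mult[OF w_free] _ u0] by blast
  \<comment> \<open>\<open>m u - y z\<close> is a cycle modulo \<open>J\<close> when \<open>z\<close> is a preimage of \<open>m w\<close>\<close>
  have soc: "\<exists>t\<in>free_module F (Suc (Suc i)). \<forall>k. m * u k - ?d' t k \<in> var_ideal (insert b X)"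
    if m: "m \<in> S 1" for m
  proof -
    obtain z where z_free: "z \<in> free_module F (Suc i)" and z: "\<And>j. m * w j - ?d z j \<in> ?J"
      using w_soc[OF m] by blast
    have dmu: "?d (\<lambda>k. m * u k - y * z k) j \<in> ?J" for j
    proof -
      have "y * (m * w j - ?d z j) - m * (y * w j - ?d u j) \<in> ?J"
        by (rule is_ideal_diff[OF J is_ideal_mult[OF J z] is_ideal_mult[OF J u]])
      then show ?thesis by (simp add: diff_map_diff diff_map_mult algebra_simps)
    qed
    have mu: "(\<lambda>k. m * u k - y * z k) \<in> free_module F (Suc i)"
      using u_free z_free by (intro free_module_diff free_module_mult)
    obtain t where t: "t \<in> free_module F (Suc (Suc i))"
        and *: "\<And>k. m * u k - y * z k - ?d' t k \<in> ?J"
      using dmu by (rule exact_modE[OF ex mu]) (rule that)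
    have "m * u k - ?d' t k \<in> var_ideal (insert b X)" for k
      using var_ideal_insertI[OF b(1) *, of k "z k"] by (simp add: y_def algebra_simps)
    with t show ?thesis by blast
  qed
  \<comment> \<open>if \<open>u\<close> is a boundary plus \<open>y q\<close>, cancelling \<open>y\<close> shows that \<open>w\<close> is the boundary of \<open>q\<close>\<close>
  have nz: False if t: "t \<in> free_module F (Suc (Suc i))"
    and ut: "\<And>k. u k - ?d' t k \<in> var_ideal (insert b X)" for t
  proof -
    have ut_free: "(\<lambda>k. u k - ?d' t k) \<in> free_module F (Suc i)"
      using u_free by (intro free_module_diff diff_map_in_free_module)
    have ut_split: "\<exists>a\<in>?J. \<exists>r. u k - ?d' t k = a + y * r" for k
      unfolding y_def by (rule var_ideal_insert[OF b(1) ut[of k]]) blast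
    obtain q where q: "q \<in> free_module F (Suc i)"
      and *: "\<And>k. u k - ?d' t k - y * q k \<in> ?J"
      by (rule free_module_split[OF J ut_free ut_split]) (rule that)
    have "w j - ?d q j \<in> ?J" for j
    proof -
      have "?d (\<lambda>k. u k - ?d' t k - y * q k) j \<in> ?J"
        using J * by (rule diff_map_in_ideal)
      then have "?d u j - y * ?d q j \<in> ?J"
        using F(1) t by (simp add: is_complex_def diff_map_diff diff_map_mult)
      then have "(y * w j - ?d u j) + (?d u j - y * ?d q j) \<in> ?J"
        using J u by (intro is_ideal_add)
      then have "\<iota> b * (w j - ?d q j) \<in> ?J" by (simp add: y_def algebra_simps)
      then show ?thesis by (rule var_regular[OF b])
    qed
    then show False using w_nz q by blast
  qed
  have "socle_class (var_ideal (insert b X)) F (Suc i) (D + 1) u"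
    unfolding socle_class_def using u_free u_deg soc nz by blast
  then show ?thesis by blast
qed

text \<open>In homological terms: a socle element of degree \<open>e\<close> gives a non-zero element of degree
  \<open>e + d\<close> in the \<open>d\<close>-th Tor module with the residue field, for \<open>d\<close> the number of variables.\<close>

lemma generator_of_socle_class:
  assumes F: "is_complex F" "\<forall>i. \<forall>j < rank F i. \<forall>k < rank F (Suc i).
      diff F i j k \<in> int_graded S (shift F (Suc i) k - shift F i j)"
    and ex: "\<And>i. exact_mod {0} F i"
    and w: "socle_class {0} F 0 e w"
  shows "\<exists>j < rank F (card B). shift F (card B) j = e + int (card B)"
proof -
  have "(\<forall>i\<ge>card X. exact_mod (var_ideal X) F i) \<and>
      (\<exists>w. socle_class (var_ideal X) F (card X) (e + int (card X)) w)" if "X \<subseteq> B" for X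
    using finite_subset[OF that finite_B] that
  proof (induction X rule: finite_induct)
    case empty
    show ?case using ex w by (auto simp: var_ideal_empty)
  next
    case (insert b X)
    then have b: "b \<in> B" "b \<notin> X" and IH: "\<And>i. i \<ge> card X \<Longrightarrow> exact_mod (var_ideal X) F i"
      "\<exists>w. socle_class (var_ideal X) F (card X) (e + int (card X)) w"
      by auto
    have "exact_mod (var_ideal (insert b X)) F i" if "i \<ge> card (insert b X)" for i
    proof -
      have "Suc (card X) \<le> i" using that insert(1,2) by simp
      then obtain i' where i': "i = Suc i'" "i' \<ge> card X"
        using Suc_le_D by auto
      show ?thesis unfolding i'
      proof (rule exact_mod_add_regular[OF is_ideal_var_ideal F(1)])
        show "exact_mod (var_ideal X) F i'" "exact_mod (var_ideal X) F (Suc i')"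
          using IH(1) i' by auto
        show "s \<in> var_ideal X" if "\<iota> b * s \<in> var_ideal X" for s
          using var_regular b that by blast
        show "\<exists>a\<in>var_ideal X. \<exists>r. s = a + \<iota> b * r" if "s \<in> var_ideal (insert b X)" for s
          by (rule var_ideal_insert[OF b(1) that]) blast
        show "a + \<iota> b * r \<in> var_ideal (insert b X)" if "a \<in> var_ideal X" for a r
          using var_ideal_insertI b that by blast
      qed
    qed
    moreover obtain w where w: "socle_class (var_ideal X) F (card X) (e + int (card X)) w"
      using IH(2) by blast
    have "\<exists>w. socle_class (var_ideal (insert b X)) F (Suc (card X)) (e + int (card X) + 1) w"
      using F b IH(1) w by (intro socle_class_step) auto
    ultimately show ?case using insert by (simp add: add_ac)
  qed
  from this[OF subset_refl] obtain w
    where w: "socle_class (var_ideal B) F (card B) (e + int (card B)) w" by blast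
  have J: "is_ideal (var_ideal B)" by (rule is_ideal_var_ideal)
  have "\<exists>j. w j \<notin> var_ideal B"
  proof (rule ccontr)
    assume "\<not> ?thesis"
    then have "\<forall>j. w j - diff_map F (card B) (\<lambda>_. 0) j \<in> var_ideal B"
      by (simp add: diff_map_def)
    moreover have "(\<lambda>_. 0) \<in> free_module F (Suc (card B))" by (simp add: free_module_def)
    ultimately show False using w unfolding socle_class_def by blast
  qed
  then obtain j where j: "w j \<notin> var_ideal B" by blast
  have rank: "j < rank F (card B)"
    using w j is_ideal_zero[OF J] unfolding socle_class_def free_module_def
    by (metis (mono_tags, lifting) mem_Collect_eq not_le)
  let ?D = "e + int (card B) - shift F (card B) j"
  have "w j \<in> int_graded S ?D"
    using w rank unfolding socle_class_def by blast
  moreover have "w j \<noteq> 0"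
    using j is_ideal_zero[OF J] by metis
  ultimately have "?D \<ge> 0" "w j \<in> S (nat ?D)"
    by (auto simp: int_graded_def split: if_splits)
  then have "?D = 0"
    using j S_subset_var_ideal[of "w j" "nat ?D"] by linarith
  then show ?thesis using rank by auto
qed

end


section \<open>Multiplication pairings\<close>

context comm_algebra
begin

lemma finite_dimensional_if_finite_span:
  assumes "finite C" "span C = UNIV"
  shows "\<exists>D. finite_dimensional_vector_space scale D"
proof -
  obtain D where "independent D" "UNIV \<subseteq> span D" by (rule basis_exists) (rule that)
  moreover from this have "finite D"
    using independent_span_bound[OF assms(1), of D] assms(2) by simp
  ultimately have "finite_dimensional_vector_space scale D"
    by unfold_locales (simp_all add: top.extremum_unique)
  then show ?thesis by blast
qed

lemma inj_on_if_dim_le: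
  assumes "finite C" "span C = UNIV" "Vector_Spaces.linear scale scale f" "subspace U"
    and "dim U \<le> dim (f ` U)"
  shows "inj_on f U"
proof -
  obtain C' where "finite_dimensional_vector_space scale C'"
    using finite_dimensional_if_finite_span assms(1,2) by blast
  then interpret fd: finite_dimensional_vector_space scale C' .
  interpret f: module_hom scale scale f
    using assms(3) by (simp add: module_hom_iff_linear)
  obtain D where D: "D \<subseteq> U" "independent D" "U \<subseteq> span D" "card D = dim U"
    by (rule basis_exists) (rule that)
  have fin: "finite D" using D(2) by (rule fd.finiteI_independent)
  have span_D: "span D = U" by (rule span_subspace[OF D(1,3) assms(4)])
  have span_fD: "span (f ` D) = f ` U" using f.span_image[of D] span_D by simp
  have "dim (f ` U) \<le> card (f ` D)" 
    using fin by (intro dim_le_card finite_imageI) (simp only: span_fD)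
  then have card: "card (f ` D) = card D" using assms(5) D(4) fin card_image_le[of D f] by simp
  have "independent (f ` D)"
  proof (rule fd.card_le_dim_spanning[of _ "f ` U"])
    show "f ` D \<subseteq> f ` U" using D by blast
    show "f ` U \<subseteq> span (f ` D)" by (simp add: span_fD)
    show "finite (f ` D)" using fin by simp
    show "card (f ` D) \<le> dim (f ` U)" using card D(4) assms(5) by simp
  qed
  moreover have "inj_on f D" by (rule eq_card_imp_inj_on[OF fin card])
  ultimately have "inj_on f (span D)"
    using f.inj_on_span_iff_independent_image[of D] by metis
  then show ?thesis by (simp only: span_D)
qed

text \<open>A multiplication pairing with values in a line that has no kernel in the first factor
  embeds this factor into the dual of the second one.\<close>

lemma dim_le_of_pairing:
  assumes fin: "finite C" "span C = UNIV"
    and U: "subspace U" and W: "subspace W" and T: "dim T = 1"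
    and UW: "\<And>u w. u \<in> U \<Longrightarrow> w \<in> W \<Longrightarrow> u * w \<in> T"
    and nondegenerate: "\<And>u. u \<in> U \<Longrightarrow> u \<noteq> 0 \<Longrightarrow> \<exists>w\<in>W. u * w \<noteq> 0"
  shows "dim U \<le> dim W"
proof -
  obtain C' where "finite_dimensional_vector_space scale C'"
    using finite_dimensional_if_finite_span fin by blast
  then interpret fd: finite_dimensional_vector_space scale C' .
  interpret pair: finite_dimensional_vector_space_pair_1 scale C' scale
    by unfold_locales
  \<comment> \<open>a linear form \<open>\<phi>\<close> on the whole algebra that is injective on \<open>T\<close>\<close>
  obtain \<sigma> where \<sigma>: "independent {\<sigma>}" "T \<subseteq> span {\<sigma>}"
  proof -
    obtain D where D: "independent D" "T \<subseteq> span D" "card D = dim T"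
      by (rule basis_exists) (rule that)
    then obtain \<sigma> where "D = {\<sigma>}" using T card_1_singletonE by metis
    then show ?thesis using that D by blast
  qed
  define \<phi> where "\<phi> a = representation (extend_basis {\<sigma>}) a \<sigma>" for a
  have ext: "independent (extend_basis {\<sigma>})" "span (extend_basis {\<sigma>}) = UNIV"
    "\<sigma> \<in> extend_basis {\<sigma>}"
    using independent_extend_basis[OF \<sigma>(1)] span_extend_basis[OF \<sigma>(1)]
      extend_basis_superset[OF \<sigma>(1)] by auto
  have \<phi>: "\<phi> (a + b) = \<phi> a + \<phi> b" "\<phi> (scale c a) = c * \<phi> a" for a b c
    using ext by (simp_all add: \<phi>_def representation_add representation_scale)
  have \<phi>_T: "a = 0" if a_T: "a \<in> T" "\<phi> a = 0" for a
  proof -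
    obtain c where a: "a = scale c \<sigma>" using a_T \<sigma> by (auto simp: span_singleton)
    have "\<phi> \<sigma> = 1" using ext by (simp add: \<phi>_def representation_basis)
    then show ?thesis using a a_T \<phi>(2) by simp
  qed
  obtain D where D: "D \<subseteq> W" "independent D" "W \<subseteq> span D"
    by (rule basis_exists) (rule that)
  have finD: "finite D" using D(2) by (rule fd.finiteI_independent)
  \<comment> \<open>the functional \<open>\<phi> (u * _)\<close> on \<open>W\<close>, recorded as its vector of values on the basis \<open>D\<close>\<close>
  define f where "f u = (\<Sum>w\<in>D. scale (\<phi> (u * w)) w)" for u
  have lin: "Vector_Spaces.linear scale scale f"
    by (simp add: Vector_Spaces.linear_iff vector_space_axioms f_def distrib_right \<phi>
        scale_mult_left[symmetric] scale_left_distrib sum.distrib scale_sum_right)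
  have "u = 0" if u: "u \<in> U" "f u = 0" for u
  proof (rule ccontr)
    assume "u \<noteq> 0"
    then obtain w where w: "w \<in> W" "u * w \<noteq> 0" using nondegenerate u by blast
    have "u * w' = 0" if w': "w' \<in> D" for w'
    proof (rule \<phi>_T)
      show "u * w' \<in> T" using UW u(1) D(1) w' by blast
      show "\<phi> (u * w') = 0"
        using independentD[OF D(2) finD subset_refl _ w', of "\<lambda>w. \<phi> (u * w)"] u(2)
        by (simp add: f_def)
    qed
    then have "span D \<subseteq> {w. u * w = 0}"
      by (intro span_minimal subspaceI) (auto simp: distrib_left scale_mult_right[symmetric])
    then show False using w D by blast
  qed
  then have "inj_on f U"
    using module_hom.inj_on_iff_eq_0[OF lin[folded module_hom_iff_linear] U] by blast
  moreover have "span U = U" using U by simp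
  ultimately have "inj_on f (span U)" by (simp only:)
  then have "dim U = dim (f ` U)"
    using pair.dim_image_eq[OF lin] by simp
  also have "f ` U \<subseteq> W"
    using D(1) W by (auto simp: f_def intro!: subspace_sum subspace_scale)
  then have "dim (f ` U) \<le> dim W" by (rule fd.dim_subset)
  finally show ?thesis .
qed

end

section \<open>Graded components of an algebra\<close>

context standard_graded_algebra
begin

text \<open>The homogeneous components of an element.\<close>

definition component :: "'a \<Rightarrow> nat \<Rightarrow> 'a" where
  "component a =
     (THE f. (\<forall>i. f i \<in> A i) \<and> finite {i. f i \<noteq> 0} \<and> a = (\<Sum>i | f i \<noteq> 0. f i))"

lemma component_in: "component a i \<in> A i"
  and finite_component: "finite {i. component a i \<noteq> 0}"
  and sum_component: "(\<Sum>i | component a i \<noteq> 0. component a i) = a"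
  using theI'[OF direct_sum[of a]] unfolding component_def[symmetric] by metis+

lemma component_eqI:
  assumes "finite K" "\<And>i. f i \<in> A i" "\<And>i. i \<notin> K \<Longrightarrow> f i = 0" "a = sum f K"
  shows "component a = f"
  unfolding component_def
proof (rule the1_equality[OF direct_sum], intro conjI allI)
  have sub: "{i. f i \<noteq> 0} \<subseteq> K" using assms(3) by blast
  show "finite {i. f i \<noteq> 0}" using sub assms(1) by (rule finite_subset)
  show "a = (\<Sum>i | f i \<noteq> 0. f i)"
    using assms(1,4) sub by (auto intro: sum.mono_neutral_right)
qed (rule assms(2))

lemma zero_in [simp]: "0 \<in> A i"
  using subspace_component subspace_0 by blast

lemma component_homogeneous: "a \<in> A i \<Longrightarrow> component a j = (if j = i then a else 0)"
  using component_eqI[of "{i}" "\<lambda>j. if j = i then a else 0" a] by auto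

lemma component_add: "component (a + b) i = component a i + component b i"
proof -
  let ?K = "{i. component a i \<noteq> 0} \<union> {i. component b i \<noteq> 0}"
  have K: "finite ?K" using finite_component by simp
  have "sum (component c) ?K = c" if "c = a \<or> c = b" for c
  proof -
    have "sum (component c) ?K = (\<Sum>i | component c i \<noteq> 0. component c i)"
      using K that by (intro sum.mono_neutral_right) auto
    then show ?thesis by (simp only: sum_component)
  qed
  then have "a + b = (\<Sum>i\<in>?K. component a i + component b i)"
    by (simp add: sum.distrib)
  then have "component (a + b) = (\<lambda>i. component a i + component b i)"
    using K by (intro component_eqI[of ?K])
      (auto intro: component_in subspace_add[OF subspace_component])
  then show ?thesis by simp
qed

lemma component_zero [simp]: "component 0 i = 0"
  using component_homogeneous[of 0 0 i] by simp

lemma component_scale: "component (scale c a) i = scale c (component a i)"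
proof -
  let ?K = "{i. component a i \<noteq> 0}"
  have "component (scale c a) = (\<lambda>i. scale c (component a i))"
    using finite_component[of a] sum_component[of a]
    by (intro component_eqI[of ?K])
      (auto intro: component_in subspace_scale[OF subspace_component] simp: scale_sum_right[symmetric])
  then show ?thesis by simp
qed

lemma component_sum: "component (sum f I) i = (\<Sum>j\<in>I. component (f j) i)"
  by (induction I rule: infinite_finite_induct) (simp_all add: component_add)

lemma components_independent: "a \<in> A i \<Longrightarrow> a \<in> A j \<Longrightarrow> i \<noteq> j \<Longrightarrow> a = 0"
  using component_homogeneous[of a i i] component_homogeneous[of a j i] by simp

lemma one_in: "1 \<in> A 0"
  using component_0 by (metis rangeI scale_one)

lemma prod_list_in: "set xs \<subseteq> A 1 \<Longrightarrow> prod_list xs \<in> A (length xs)"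
  by (induction xs) (use mult_component[of _ 1] in \<open>auto simp: one_in\<close>)

lemma component_eq_forms: "A i = forms (A 1) i"
proof
  let ?T = "{a. \<forall>i. component a i \<in> forms (A 1) i}"
  have "subspace ?T"
    by (intro subspaceI)
      (auto simp: component_add component_scale subspace_0 subspace_add subspace_scale)
  moreover have "prod_list xs \<in> ?T" if "set xs \<subseteq> A 1" for xs
    using component_homogeneous[OF prod_list_in[OF that]] prod_list_in_forms[OF that]
    by (auto simp: subspace_0)
  ultimately have "span {prod_list xs | xs. set xs \<subseteq> A 1} \<subseteq> ?T"
    by (intro span_minimal) auto
  then have T: "component a i \<in> forms (A 1) i" for a
    using generated_by_component_1 by auto
  show "A i \<subseteq> forms (A 1) i"
  proof
    fix a assume "a \<in> A i"
    then show "a \<in> forms (A 1) i" using T[of a] component_homogeneous[of a i i] by simp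
  qed
  show "forms (A 1) i \<subseteq> A i"
    unfolding forms_def using prod_list_in subspace_component by (intro span_minimal) auto
qed

lemma finite_dimensional_component: "\<exists>C. finite C \<and> A i \<subseteq> span C"
proof (induction i)
  case 0
  show ?case using component_0 by (intro exI[of _ "{1}"]) (auto simp: span_singleton)
next
  case (Suc i)
  then obtain C where C: "finite C" "A i \<subseteq> span C" by blast
  obtain D where D: "finite D" "span D = A 1" using finite_dimensional_component_1 by blast
  let ?P = "{x * y | x y. x \<in> D \<and> y \<in> C}"
  have "prod_list xs \<in> span ?P" if set: "set xs \<subseteq> A 1" "length xs = Suc i" for xs
  proof -
    obtain y ys where xs: "xs = y # ys" "y \<in> A 1" "set ys \<subseteq> A 1" "length ys = i"
      using set by (auto simp: length_Suc_conv)
    then have "y \<in> span D" "prod_list ys \<in> span C"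
      using C D prod_list_in by auto
    then show ?thesis unfolding xs using span_mult by simp
  qed
  then have "A (Suc i) \<subseteq> span ?P"
    unfolding component_eq_forms[of "Suc i"] forms_def by (intro span_minimal) auto
  moreover have "finite ?P" using C D by (simp add: finite_image_set2)
  ultimately show ?case by blast
qed

text \<open>The descending chain of the ideals of elements without components of degree less than \<open>n\<close> is
  stationary.\<close>

lemma eventually_zero_if_artinian:
  assumes "artinian_ring TYPE('a)"
  shows "\<exists>N. \<forall>i\<ge>N. A i = {0}"
proof -
  define I where "I n = {a. \<forall>i<n. component a i = 0}" for n
  have "c * a \<in> I n" if a: "a \<in> I n" for c a n
  proof -
    have "component (component c j * component a k) i = 0" if "i < n" for i j k
      using mult_component[OF component_in[of c j] component_in[of a k]] that a
      by (cases "k < n") (auto simp: I_def component_homogeneous)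
    moreover have "c * a = (\<Sum>j | component c j \<noteq> 0. \<Sum>k | component a k \<noteq> 0. component c j * component a k)"
      unfolding sum_product[symmetric] sum_component by (rule refl)
    ultimately show ?thesis by (simp add: I_def component_sum)
  qed
  then have "is_ideal (I n)" for n
    unfolding is_ideal_def by (subst module.subspace_def[OF module_times]) (auto simp: I_def component_add)
  moreover have "I (Suc n) \<subseteq> I n" for n by (auto simp: I_def)
  ultimately obtain N where N: "\<And>n. n \<ge> N \<Longrightarrow> I n = I N"
    using assms unfolding artinian_ring_def by metis
  have "a = 0" if "i \<ge> N" "a \<in> A i" for i a
  proof -
    have "a \<in> I i" using that by (simp add: I_def component_homogeneous)
    then have "a \<in> I (Suc i)" using N[of i] N[of "Suc i"] that by simp
    then show ?thesis using that by (auto simp: I_def component_homogeneous)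
  qed
  then show ?thesis using zero_in by blast
qed

end

section \<open>Artinian Gorenstein algebras\<close>

text \<open>An Artinian Gorenstein algebra of socle degree \<open>e\<close>, the last degree in which it is not zero.\<close>

locale gorenstein_algebra = standard_graded_algebra scale A
  for scale :: "'k::field \<Rightarrow> 'a::comm_ring_1 \<Rightarrow> 'a" and A +
  fixes e :: nat
  assumes gorenstein: "artinian_gorenstein scale A"
    and nonzero: "A e \<noteq> {0}"
    and zero_above: "i > e \<Longrightarrow> A i = {0}"
begin

lemma finite_dimensional: "\<exists>C. finite C \<and> span C = UNIV"
proof -
  obtain C where C: "\<And>i. finite (C i) \<and> A i \<subseteq> span (C i)"
    using finite_dimensional_component by metis
  let ?C = "\<Union>i\<le>e. C i"
  have "a \<in> span ?C" for a
  proof -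
    have "component a i \<in> span ?C" for i
    proof (cases "i \<le> e")
      case True
      then show ?thesis using C[of i] component_in[of a i] span_mono[of "C i" ?C] by blast
    next
      case False
      then show ?thesis using zero_above[of i] component_in[of a i] by (simp add: span_zero)
    qed
    then have "(\<Sum>i | component a i \<noteq> 0. component a i) \<in> span ?C" by (intro span_sum)
    then show ?thesis by (simp add: sum_component)
  qed
  then show ?thesis using C by (intro exI[of _ ?C]) auto
qed

lemma socle_eq: "socle scale A = A e" and dim_top: "dim (A e) = 1"
proof -
  obtain C where "finite_dimensional_vector_space scale C"
    using finite_dimensional finite_dimensional_if_finite_span by blast
  then interpret fd: finite_dimensional_vector_space scale C .
  have sub: "A e \<subseteq> socle scale A"
  proof
    fix a assume a: "a \<in> A e"
    have "positive_part A \<subseteq> {m. a * m = 0}"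
      unfolding positive_part_def
    proof (rule span_minimal)
      show "(\<Union>i\<in>{1..}. A i) \<subseteq> {m. a * m = 0}"
        using mult_component[OF a] zero_above by fastforce
      show "subspace {m. a * m = 0}"
        by (intro subspaceI) (auto simp: distrib_left scale_mult_right[symmetric])
    qed
    then show "a \<in> socle scale A" by (auto simp: socle_def)
  qed
  have sub_socle: "subspace (socle scale A)"
    by (intro subspaceI) (auto simp: socle_def distrib_right scale_mult_left[symmetric])
  have socle: "dim (socle scale A) = 1" using gorenstein by (simp add: artinian_gorenstein_def)
  have "dim (A e) \<noteq> 0"
    using nonzero zero_in[of e] fd.dim_eq_0[of "A e"] by blast
  then have "dim (socle scale A) \<le> dim (A e)" unfolding socle by linarith
  then show "socle scale A = A e"
    using fd.subspace_dim_equal[OF subspace_component sub_socle sub] by simp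
  then show "dim (A e) = 1" using socle by simp
qed

text \<open>The pairing of \<open>A\<^sub>i\<close> with \<open>A\<^sub>e\<^sub>-\<^sub>i\<close>: an element of degree less than \<open>e\<close> is not in the socle, so some
  linear form does not kill it, and its degree can be raised until it is \<open>e\<close>.\<close>

lemma nondegenerate:
  assumes "a \<in> A i" "a \<noteq> 0"
  shows "i \<le> e" "\<exists>b\<in>A (e - i). a * b \<noteq> 0"
proof -
  show i: "i \<le> e"
    using zero_above[of i] assms by (metis not_le singletonD)
  show "\<exists>b\<in>A (e - i). a * b \<noteq> 0"
    using i assms
  proof (induction "e - i" arbitrary: i a)
    case 0
    then show ?case using one_in by (intro bexI[of _ 1]) auto
  next
    case (Suc l)
    then have "i \<noteq> e" by linarith
    then have "a \<notin> socle scale A"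
      using components_independent[of a i e] socle_eq Suc.prems by auto
    then obtain m where m: "m \<in> positive_part A" "a * m \<noteq> 0"
      by (auto simp: socle_def)
    have "\<exists>y\<in>A 1. a * y \<noteq> 0"
    proof (rule ccontr)
      assume *: "\<not> ?thesis"
      have sub: "subspace {m. a * m = 0}"
        by (intro subspaceI) (auto simp: distrib_left scale_mult_right[symmetric])
      have "A j \<subseteq> {m. a * m = 0}" if "j \<ge> 1" for j
        unfolding component_eq_forms[of j] forms_def
      proof (rule span_minimal[OF _ sub])
        have "a * prod_list xs = 0" if "set xs \<subseteq> A 1" "length xs = j" for xs
          using that \<open>j \<ge> 1\<close> * by (cases xs) (auto simp: mult.assoc[symmetric])
        then show "{prod_list xs | xs. set xs \<subseteq> A 1 \<and> length xs = j} \<subseteq> {m. a * m = 0}" by auto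
      qed
      then have "positive_part A \<subseteq> {m. a * m = 0}"
        unfolding positive_part_def using sub by (intro span_minimal) auto
      then show False using m by blast
    qed
    then obtain y where y: "y \<in> A 1" "a * y \<noteq> 0" by blast
    have "a * y \<in> A (Suc i)" using mult_component[OF Suc.prems(2) y(1)] by simp
    moreover have "l = e - Suc i" "Suc i \<le> e" using Suc.hyps(2) by linarith+
    ultimately obtain b where b: "b \<in> A (e - Suc i)" "a * y * b \<noteq> 0"
      using Suc.hyps(1) y(2) by blast
    have "y * b \<in> A (e - i)"
      using mult_component[OF y(1) b(1)] Suc.hyps(2) by (simp add: Suc_diff_Suc)
    then show ?case using b by (intro bexI[of _ "y * b"]) (simp_all add: mult.assoc)
  qed
qed

text \<open>Injectivity in low degrees dualizes to surjectivity in high degrees.\<close>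

lemma surjective_of_injective:
  assumes x: "x \<in> A 1" and i: "i < e"
    and inj: "\<And>a. a \<in> A (e - Suc i) \<Longrightarrow> x * a = 0 \<Longrightarrow> a = 0"
  shows "(\<lambda>a. x * a) ` A i = A (Suc i)"
proof -
  obtain C where C: "finite C" "span C = UNIV" using finite_dimensional by blast
  obtain C' where "finite_dimensional_vector_space scale C'"
    using finite_dimensional_if_finite_span C by blast
  then interpret fd: finite_dimensional_vector_space scale C' .
  let ?W = "(\<lambda>a. x * a) ` A i"
  have lin: "module_hom scale scale (\<lambda>a. x * a)"
    using linear_mult by (simp add: module_hom_iff_linear)
  have W: "subspace ?W"
    using module_hom.subspace_image[OF lin subspace_component] .
  have W_sub: "?W \<subseteq> A (Suc i)"
    using mult_component[OF x] by auto
  have e: "A (e - Suc i + Suc i) = A e" using i by simp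
  have "dim (A (e - Suc i)) \<le> dim ?W"
  proof (rule dim_le_of_pairing[OF C subspace_component W dim_top])
    show "u * w \<in> A e" if "u \<in> A (e - Suc i)" "w \<in> ?W" for u w
      using mult_component[of u "e - Suc i" w "Suc i"] that W_sub e by blast
    show "\<exists>w\<in>?W. c * w \<noteq> 0" if c: "c \<in> A (e - Suc i)" "c \<noteq> 0" for c
    proof -
      have "x * c \<noteq> 0" using inj c by blast
      moreover have "x * c \<in> A (e - i)"
        using mult_component[OF x c(1)] i by (simp add: Suc_diff_Suc)
      ultimately obtain b where b: "b \<in> A (e - (e - i))" "x * c * b \<noteq> 0"
        using nondegenerate(2) by blast
      have "x * b \<in> ?W" using b(1) i by simp
      moreover have "c * (x * b) \<noteq> 0" using b(2) by (simp add: ac_simps)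
      ultimately show ?thesis by blast
    qed
  qed
  moreover have "dim (A (Suc i)) \<le> dim (A (e - Suc i))"
  proof (rule dim_le_of_pairing[OF C subspace_component subspace_component dim_top])
    show "u * w \<in> A e" if "u \<in> A (Suc i)" "w \<in> A (e - Suc i)" for u w
      using mult_component[of u "Suc i" w "e - Suc i"] that e by (simp add: add.commute)
    show "\<exists>w\<in>A (e - Suc i). c * w \<noteq> 0" if "c \<in> A (Suc i)" "c \<noteq> 0" for c
      using nondegenerate(2) that by blast
  qed
  ultimately show ?thesis
    using fd.subspace_dim_equal[OF W subspace_component W_sub] by simp
qed

text \<open>Since \<open>e \<le> 2q\<close>, a degree \<open>i\<close> with \<open>q \<le> i < e\<close> has \<open>e - i - 1 < q\<close>, so each degree is covered by
  injectivity or by its dual.\<close>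

lemma weak_Lefschetz_of_injective:
  assumes x: "x \<in> A 1" and q: "e \<le> 2 * q"
    and inj: "\<And>i a. i < q \<Longrightarrow> a \<in> A i \<Longrightarrow> x * a = 0 \<Longrightarrow> a = 0"
  shows "weak_Lefschetz_element scale A x"
proof -
  obtain C where C: "finite C" "span C = UNIV" using finite_dimensional by blast
  obtain C' where "finite_dimensional_vector_space scale C'"
    using finite_dimensional_if_finite_span C by blast
  then interpret fd: finite_dimensional_vector_space scale C' .
  interpret pair: finite_dimensional_vector_space_pair_1 scale C' scale
    by unfold_locales
  let ?f = "\<lambda>a. x * a"
  have sub: "?f ` A i \<subseteq> A (Suc i)" for i
    using mult_component[OF x] by auto
  have lin: "module_hom scale scale ?f"
    using linear_mult by (simp add: module_hom_iff_linear)
  have image: "subspace (?f ` A i)" for i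
    using module_hom.subspace_image[OF lin subspace_component] .
  have low: "inj_on ?f (A i)" "dim (A (Suc i)) \<le> dim (A i) \<Longrightarrow> ?f ` A i = A (Suc i)"
    if "i < q" for i
  proof -
    show inj_i: "inj_on ?f (A i)"
      using module_hom.inj_on_iff_eq_0[OF lin subspace_component] inj that by blast
    moreover have "span (A i) = A i" using subspace_component by simp
    ultimately have "inj_on ?f (span (A i))" by (simp only:)
    then have "dim (?f ` A i) = dim (A i)" by (rule pair.dim_image_eq[OF linear_mult])
    then show "?f ` A i = A (Suc i)" if "dim (A (Suc i)) \<le> dim (A i)"
      using that fd.subspace_dim_equal[OF image subspace_component sub] by simp
  qed
  have high: "?f ` A i = A (Suc i)" if "i \<ge> q" for i
  proof (cases "i < e")
    case True
    then have "e - Suc i < q" using q that by linarith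
    then show ?thesis using inj by (intro surjective_of_injective[OF x True]) blast
  next
    case False
    then have "A (Suc i) = {0}" using zero_above[of "Suc i"] by simp
    moreover have "x * 0 \<in> ?f ` A i" using zero_in by (rule imageI)
    ultimately show ?thesis using sub[of i] by auto
  qed
  have "inj_on ?f (A i)" if "dim (A i) \<le> dim (A (Suc i))" for i
    using low(1)[of i] high[of i] that inj_on_if_dim_le[OF C linear_mult subspace_component]
    by (metis not_le)
  moreover have "?f ` A i = A (Suc i)" if "dim (A (Suc i)) \<le> dim (A i)" for i
    using low(2)[of i] high[of i] that by (metis not_le)
  ultimately show ?thesis using x by (simp add: weak_Lefschetz_element_def)
qed

end

lemma (in standard_graded_algebra) gorenstein_algebra_exists:
  assumes "artinian_gorenstein scale A"
  shows "\<exists>e. gorenstein_algebra scale A e"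
proof -
  obtain N where N: "\<And>i. i \<ge> N \<Longrightarrow> A i = {0}"
    using eventually_zero_if_artinian assms by (auto simp: artinian_gorenstein_def)
  let ?P = "\<lambda>i. A i \<noteq> {0}"
  have "1 \<in> A 0" "(1::'a) \<noteq> 0" using one_in by auto
  then have 0: "?P 0" by blast
  have bound: "\<forall>i. ?P i \<longrightarrow> i \<le> N" using N by (metis nle_le)
  have "?P (Greatest ?P)" using GreatestI_nat[of ?P, OF 0] bound by blast
  moreover have "A i = {0}" if "i > Greatest ?P" for i
    using Greatest_le_nat[of ?P i N] bound that by (metis not_le)
  ultimately have "gorenstein_algebra scale A (Greatest ?P)"
    using assms by unfold_locales auto
  then show ?thesis by blast
qed


section \<open>Gorenstein-linear resolutions\<close>

lemma is_complex_if_exact: "exact_complex \<pi> F \<Longrightarrow> is_complex F"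
  unfolding exact_complex_def is_complex_def by blast

lemma exact_mod_zero_if_exact:
  assumes "exact_complex \<pi> F"
  shows "exact_mod {0} F i"
  unfolding exact_mod_def
proof (intro ballI impI)
  fix v assume "v \<in> free_module F (Suc i)" "\<forall>j. diff_map F i v j \<in> {0}"
  then have "v \<in> {v \<in> free_module F (Suc i). diff_map F i v = (\<lambda>_. 0)}" by auto
  then have "v \<in> diff_map F (Suc i) ` free_module F (Suc (Suc i))"
    using assms unfolding exact_complex_def by blast
  then show "\<exists>u\<in>free_module F (Suc (Suc i)). \<forall>k. v k - diff_map F (Suc i) u k \<in> {0}" by auto
qed

lemma aug_map_single:
  assumes "j < rank F 0" "\<pi> 0 = 0"
  shows "aug_map \<pi> F (\<lambda>k. if k = j then s else 0) = \<pi> s * aug F j"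
proof -
  have "\<pi> (if k = j then s else 0) * aug F k = (if k = j then \<pi> s * aug F j else 0)" for k
    using assms by simp
  then show ?thesis using assms by (simp add: aug_map_def)
qed

theorem proposition7p1:
  fixes scale :: "'k::field \<Rightarrow> 'a::comm_ring_1 \<Rightarrow> 'a"
    and A :: "nat \<Rightarrow> 'a set"
    and scaleS :: "'k \<Rightarrow> 's::comm_ring_1 \<Rightarrow> 's"
    and \<iota> :: "'a \<Rightarrow> 's"
    and \<pi> :: "'s \<Rightarrow> 'a"
    and F :: "('s, 'a) free_complex"
    and x :: 'a
  assumes "standard_graded_algebra scale A"
    and "artinian_gorenstein scale A"
    and "symmetric_algebra scale (A 1) scaleS \<iota>"
    and "algebra_hom scaleS scale \<pi>" and "\<And>v. v \<in> A 1 \<Longrightarrow> \<pi> (\<iota> v) = v"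
    and "minimal_homogeneous_resolution scaleS (comm_algebra.forms scaleS (\<iota> ` A 1)) A \<pi> F"
    and "Gorenstein_linear F"
    and "x \<in> A 1" and "x \<noteq> 0"
  shows "weak_Lefschetz_element scale A x"
proof -
  obtain e where "gorenstein_algebra scale A e"
    using standard_graded_algebra.gorenstein_algebra_exists[OF assms(1,2)] by blast
  then interpret A: gorenstein_algebra scale A e .
  have \<pi>_add: "\<pi> (a + b) = \<pi> a + \<pi> b" and \<pi>_mult: "\<pi> (a * b) = \<pi> a * \<pi> b"
    and \<pi>_scale: "\<pi> (scaleS c a) = scale c (\<pi> a)" and \<pi>_one: "\<pi> 1 = 1" for a b c
    using assms(4) unfolding algebra_hom_def by blast+
  have \<pi>_zero: "\<pi> 0 = 0" using \<pi>_add[of 0 0] by simp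
  have \<iota>: "\<pi> (\<iota> v) = v" if "v \<in> A 1" for v using assms(5) that .

  \<comment> \<open>a basis of the linear forms that contains \<open>x\<close>\<close>
  obtain C where C: "finite C" "A 1 \<subseteq> A.span C"
    using A.finite_dimensional_component by blast
  have "A.independent {x}" using assms(9) by simp
  then obtain B where B: "{x} \<subseteq> B" "B \<subseteq> A 1" "A.independent B" "A 1 \<subseteq> A.span B"
    using A.maximal_independent_subset_extend[of "{x}" "A 1"] assms(8) by blast
  have "B \<subseteq> A.span C" using B(2) C(2) by (rule subset_trans)
  then have finite_B: "finite B" using A.independent_span_bound[OF C(1) B(3)] by blast
  interpret S: symmetric_algebra_basis scale "A 1" scaleS \<iota> B
    using assms(3) finite_B B(3) A.span_subspace[OF B(2,4) A.subspace_component]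
    by (intro symmetric_algebra_basis.intro symmetric_algebra_basis_axioms.intro)
  have x_B: "x \<in> B" using B(1) by simp

  \<comment> \<open>\<open>\<pi>\<close> is a surjective graded map\<close>
  have \<pi>_hom: "module_hom scaleS scale \<pi>"
    using \<pi>_add \<pi>_scale S.module_axioms A.module_axioms
    by (simp add: module_hom_def module_hom_axioms_def)
  have \<pi>_list: "\<pi> (prod_list (map \<iota> ys)) = prod_list ys" if "set ys \<subseteq> A 1" for ys
    using that by (induction ys) (auto simp: \<pi>_one \<pi>_mult \<iota>)
  have gens: "\<pi> ` {prod_list xs | xs. set xs \<subseteq> \<iota> ` A 1 \<and> length xs = i}
      = {prod_list ys | ys. set ys \<subseteq> A 1 \<and> length ys = i}" for i
  proof -
    have "{prod_list xs | xs. set xs \<subseteq> \<iota> ` A 1 \<and> length xs = i}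
        = (\<lambda>ys. prod_list (map \<iota> ys)) ` {ys. set ys \<subseteq> A 1 \<and> length ys = i}"
    proof (intro equalityI subsetI)
      fix s assume "s \<in> {prod_list xs | xs. set xs \<subseteq> \<iota> ` A 1 \<and> length xs = i}"
      then obtain xs where xs: "s = prod_list xs" "set xs \<subseteq> \<iota> ` A 1" "length xs = i" by blast
      have "xs \<in> lists (\<iota> ` A 1)" using xs(2) by (simp add: in_lists_conv_set subset_iff)
      then obtain ys where "ys \<in> lists (A 1)" "xs = map \<iota> ys"
        unfolding lists_image by blast
      then show "s \<in> (\<lambda>ys. prod_list (map \<iota> ys)) ` {ys. set ys \<subseteq> A 1 \<and> length ys = i}"
        using xs by auto
    next
      fix s assume "s \<in> (\<lambda>ys. prod_list (map \<iota> ys)) ` {ys. set ys \<subseteq> A 1 \<and> length ys = i}"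
      then obtain ys where "s = prod_list (map \<iota> ys)" "set ys \<subseteq> A 1" "length ys = i" by blast
      then show "s \<in> {prod_list xs | xs. set xs \<subseteq> \<iota> ` A 1 \<and> length xs = i}"
        by (intro CollectI exI[of _ "map \<iota> ys"]) auto
    qed
    then show ?thesis by (auto simp: image_image \<pi>_list intro!: image_eqI)
  qed
  have \<pi>_S: "\<pi> ` S.S i = A i" for i
    unfolding A.component_eq_forms[of i] S.forms_def A.forms_def gens[symmetric]
    by (rule module_hom.span_image[OF \<pi>_hom, symmetric])

  have hom: "homogeneous_complex S.S A F" and ex: "exact_complex \<pi> F"
    using assms(6) by (simp_all add: minimal_homogeneous_resolution_def)
  have F_deg: "\<forall>i. \<forall>j < rank F i. \<forall>k < rank F (Suc i).
      diff F i j k \<in> int_graded S.S (shift F (Suc i) k - shift F i j)"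
    and aug_deg: "\<And>j. j < rank F 0 \<Longrightarrow> aug F j \<in> int_graded A (shift F 0 j)"
    using hom by (simp_all add: homogeneous_complex_def)
  have kernel: "{v \<in> free_module F 0. aug_map \<pi> F v = 0} = diff_map F 0 ` free_module F (Suc 0)"
    using ex by (simp add: exact_complex_def)
  obtain n :: int and t where rank0: "\<And>i. i > t \<Longrightarrow> rank F i = 0"
    and shift: "\<And>i j. i \<le> t \<Longrightarrow> j < rank F i \<Longrightarrow> shift F i j =
        (if i = 0 then 0 else if i < t then n + int i - 1 else 2 * n + int t - 2)"
    using assms(7) unfolding Gorenstein_linear_def by blast
  have shift_0: "shift F 0 j = 0" if "j < rank F 0" for j
    using shift[of 0 j] that by simp

  \<comment> \<open>a basis element of \<open>F\<^sub>0\<close> that goes to a non-zero scalar; the others play no role\<close>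
  have "1 \<in> aug_map \<pi> F ` free_module F 0" using ex by (simp add: exact_complex_def)
  then obtain v where "aug_map \<pi> F v = 1" by auto
  then have "\<exists>j < rank F 0. aug F j \<noteq> 0"
    unfolding aug_map_def
    by (metis (no_types, lifting) lessThan_iff mult_zero_right sum.neutral zero_neq_one)
  then obtain j0 where j0: "j0 < rank F 0" "aug F j0 \<noteq> 0" by blast
  have "aug F j0 \<in> A 0"
    using aug_deg[OF j0(1)] shift_0[OF j0(1)] by (simp add: int_graded_def)
  then obtain c where c: "aug F j0 = scale c 1" using A.component_0 by blast
  with j0 have "c \<noteq> 0" by auto
  define unit where "unit s = (\<lambda>k. if k = j0 then s else 0 :: 's)" for s
  have unit_free: "unit s \<in> free_module F 0" for s
    using j0 by (auto simp: unit_def free_module_def)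
  have aug_unit: "aug_map \<pi> F (unit s) = scale c (\<pi> s)" for s
    using aug_map_single[of j0 F \<pi> s] j0 \<pi>_zero
    by (simp add: unit_def c A.scale_mult_right[symmetric])

  \<comment> \<open>\<open>unit s\<close> lifts a socle element of \<open>A\<close>, up to the factor \<open>c\<close>\<close>
  obtain \<sigma> where \<sigma>: "\<sigma> \<in> A e" "\<sigma> \<noteq> 0" using A.nonzero A.zero_in by blast
  then obtain s where s: "s \<in> S.S e" "\<pi> s = \<sigma>"
    using \<pi>_S[of e] by (metis imageE)
  have soc: "S.socle_class {0} F 0 (int e) (unit s)"
    unfolding S.socle_class_def
  proof (intro conjI allI impI ballI notI)
    show "unit s \<in> free_module F 0" by (rule unit_free)
    show "unit s j \<in> int_graded S.S (int e - shift F 0 j)" if "j < rank F 0" for j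
      using s(1) shift_0[OF that] by (simp add: unit_def int_graded_def S.subspace_0)
    show "\<exists>u\<in>free_module F (Suc 0). \<forall>j. m * unit s j - diff_map F 0 u j \<in> {0}"
      if m: "m \<in> S.S 1" for m
    proof -
      have "\<pi> m \<in> A 1" using imageI[OF m, of \<pi>] by (simp only: \<pi>_S)
      then have "\<pi> m * \<sigma> \<in> A (1 + e)" using \<sigma> by (intro A.mult_component)
      then have "\<pi> (m * s) = 0" using A.zero_above[of "1 + e"] s by (simp add: \<pi>_mult)
      then have "unit (m * s) \<in> {v \<in> free_module F 0. aug_map \<pi> F v = 0}"
        by (simp add: unit_free aug_unit)
      then obtain u where "u \<in> free_module F (Suc 0)" "unit (m * s) = diff_map F 0 u"
        unfolding kernel by blast
      moreover from this have "m * unit s j = diff_map F 0 u j" for j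
        by (metis (full_types) unit_def mult_zero_right)
      ultimately show ?thesis by auto
    qed
    assume "\<exists>u\<in>free_module F (Suc 0). \<forall>j. unit s j - diff_map F 0 u j \<in> {0}"
    then have "unit s \<in> diff_map F 0 ` free_module F (Suc 0)" by (auto simp: fun_eq_iff)
    then have "scale c \<sigma> = 0" unfolding kernel[symmetric] by (simp add: aug_unit s)
    then show False using \<open>c \<noteq> 0\<close> \<sigma> by simp
  qed

  \<comment> \<open>the degrees occurring in \<open>F\<^sub>d\<close>, where \<open>d \<ge> 1\<close>, leave two values for \<open>e\<close>\<close>
  let ?d = "card B"
  obtain j where j: "j < rank F ?d" "shift F ?d j = int e + int ?d"
    using S.generator_of_socle_class[OF is_complex_if_exact[OF ex] F_deg
        exact_mod_zero_if_exact[OF ex] soc] by blast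
  have "?d \<le> t" using rank0[of ?d] j(1) by (metis not_le not_less_zero)
  moreover have "?d \<noteq> 0" using x_B finite_B by auto
  ultimately have e_cases: "int e = n - 1 \<or> int e = 2 * n - 2" and "t > 0"
    using shift[OF _ j(1)] j(2) by (auto split: if_splits)
  then have n: "n \<ge> 1" "int e \<le> 2 * n - 2" by auto

  \<comment> \<open>a relation is a combination of entries of the first matrix, which have degree at least \<open>n\<close>\<close>
  have shift_1: "shift F (Suc 0) k \<ge> n" if "k < rank F (Suc 0)" for k
    using shift[of "Suc 0" k] that \<open>t > 0\<close> n(1) by (auto split: if_splits)
  have \<pi>_inj: "r = 0" if r: "r \<in> S.S i" "int i < n" "\<pi> r = 0" for r i
  proof -
    have "unit r \<in> {v \<in> free_module F 0. aug_map \<pi> F v = 0}"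
      using r by (simp add: unit_free aug_unit)
    then obtain u where u: "unit r = diff_map F 0 u" unfolding kernel by blast
    have "r = unit r j0" by (simp add: unit_def)
    also have "\<dots> = (\<Sum>k < rank F (Suc 0). diff F 0 j0 k * u k)"
      using j0 by (simp add: u diff_map_def)
    finally have r_sum: "r = (\<Sum>k < rank F (Suc 0). diff F 0 j0 k * u k)" .
    have zero: "S.hcomp (int i) (diff F 0 j0 k * u k) = 0" if k: "k < rank F (Suc 0)" for k
    proof -
      have "diff F 0 j0 k \<in> int_graded S.S (shift F (Suc 0) k)"
        using F_deg j0(1) k shift_0[OF j0(1)] by fastforce
      then have "S.hcomp (int i) (diff F 0 j0 k * u k)
          = diff F 0 j0 k * S.hcomp (int i - shift F (Suc 0) k) (u k)"
        by (rule S.hcomp_mult)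
      moreover have "S.hcomp (int i - shift F (Suc 0) k) (u k) = 0"
        using S.hcomp_in[of "int i - shift F (Suc 0) k" "u k"] shift_1[OF k] r(2)
        by (simp add: int_graded_def)
      ultimately show ?thesis by simp
    qed
    have "r = S.hcomp (int i) r"
      using r(1) by (intro S.hcomp_same[symmetric]) (simp add: int_graded_def)
    also have "\<dots> = (\<Sum>k < rank F (Suc 0). S.hcomp (int i) (diff F 0 j0 k * u k))"
      by (subst r_sum) (simp only: S.hcomp_def S.part_sum)
    also have "\<dots> = 0" by (intro sum.neutral) (simp add: zero)
    finally show ?thesis .
  qed

  show ?thesis
  proof (rule A.weak_Lefschetz_of_injective[OF assms(8)])
    show "e \<le> 2 * nat (n - 1)" using n by linarith
    fix i a assume i: "i < nat (n - 1)" and a: "a \<in> A i" "x * a = 0"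
    obtain r where r: "r \<in> S.S i" "\<pi> r = a" using a(1) \<pi>_S[of i] by (metis imageE)
    have "\<iota> x * r \<in> S.S (1 + i)"
      using S.\<iota>_in_S[OF assms(8)] r(1) by (rule S.forms_mult)
    then have "\<iota> x * r = 0"
      using i r a(2) \<iota>[OF assms(8)] by (intro \<pi>_inj[of _ "1 + i"]) (auto simp: \<pi>_mult)
    then have "r = 0"
      using S.var_regular[OF x_B, of "{}" r] by (simp add: S.var_ideal_empty)
    then show "a = 0" using r \<pi>_zero by simp
  qed
qed

end
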